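(* Let $2\le n\le m$, let $\omega\in\Lambda^n\mathbb{R}^m$ be a calibration, let $\Omega\subset\mathbb{R}^n$ be a domain, and let $F\colon\Omega\to\mathbb{R}^m$ be a conformal $\omega$-curve. Then $F$ is affine if and only if $\|DF\|$ is constant.
   Context: Covectors in $\Lambda^n\mathbb{R}^m$ are identified with constant-coefficient differential $n$-forms on $\mathbb{R}^m$. A covector $\omega\in\Lambda^n\mathbb{R}^m$ is a calibration if $\|\omega\|_{\mathrm{comass}}:=\sup\{\omega(v_1,\ldots,v_n): v_i\in\mathbb{R}^m, |v_1|=\cdots=|v_n|=1\}=1$. $\mathrm{SO}(\omega)$ is the set of linear isometries (isometric embeddings) $O\colon\mathbb{R}^n\to\mathbb{R}^m$ with $O^*\omega=\mathrm{vol}_{\mathbb{R}^n}$, and $\mathrm{CO}(\omega)=\{\lambda O: O\in\mathrm{SO}(\omega),\lambda\ge0\}$. For $\Omega\subset\mathbb{R}^n$ open, a map $F\in W^{1,n}_{\mathrm{loc}}(\Omega,\mathbb{R}^m)$ is a conformal $\omega$-curve if $(DF)_x\in\mathrm{CO}(\omega)$ for almost every $x\in\Omega$; such maps are identified with their continuous (in fact $\mathcal{C}^1$) representatives. $\|DF\|$ is the operator norm of $DF$. *)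

theory Defs
  imports "HOL-Analysis.Analysis"
begin

section \<open>Covectors and calibrations\<close>

text \<open>
  An \<open>n\<close>-covector on \<open>\<real>\<^sup>m\<close> is an alternating multilinear form in \<open>n\<close> vectors. The arguments are
  indexed by the same finite type \<^typ>\<open>'n\<close> that indexes the coordinates of \<open>\<real>\<^sup>n\<close>, so that pulling
  back along a linear map \<open>\<real>\<^sup>n \<rightarrow> \<real>\<^sup>m\<close> and comparing with the determinant requires no ordering of
  the index type.
\<close>

definition covector :: "(('n::finite \<Rightarrow> real^'m::finite) \<Rightarrow> real) \<Rightarrow> bool" where
  "covector \<omega> \<longleftrightarrow>
     (\<forall>v i. linear (\<lambda>x. \<omega> (v(i := x)))) \<and>
     (\<forall>v i j. i \<noteq> j \<and> v i = v j \<longrightarrow> \<omega> v = 0)"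

text \<open>The supremum is taken over a nonempty set, which is bounded whenever \<open>\<omega>\<close> is multilinear.\<close>

definition comass :: "(('n::finite \<Rightarrow> real^'m::finite) \<Rightarrow> real) \<Rightarrow> real" where
  "comass \<omega> = Sup {\<omega> v | v. \<forall>i. norm (v i) = 1}"

definition calibration :: "(('n::finite \<Rightarrow> real^'m::finite) \<Rightarrow> real) \<Rightarrow> bool" where
  "calibration \<omega> \<longleftrightarrow> covector \<omega> \<and> comass \<omega> = 1"

definition vol_form :: "('n::finite \<Rightarrow> real^'n) \<Rightarrow> real" where
  "vol_form v = det (\<chi> i. v i)"

definition pullback ::
  "(real^'n::finite \<Rightarrow> real^'m::finite) \<Rightarrow> (('n \<Rightarrow> real^'m) \<Rightarrow> real) \<Rightarrow> ('n \<Rightarrow> real^'n) \<Rightarrow> real" where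
  "pullback L \<omega> v = \<omega> (\<lambda>i. L (v i))"

definition SO_cal :: "(('n::finite \<Rightarrow> real^'m::finite) \<Rightarrow> real) \<Rightarrow> (real^'n \<Rightarrow> real^'m) set" where
  "SO_cal \<omega> = {L. linear L \<and> (\<forall>x. norm (L x) = norm x) \<and> pullback L \<omega> = vol_form}"

definition CO_cal :: "(('n::finite \<Rightarrow> real^'m::finite) \<Rightarrow> real) \<Rightarrow> (real^'n \<Rightarrow> real^'m) set" where
  "CO_cal \<omega> = {(\<lambda>x. r *\<^sub>R L x) | r L. r \<ge> 0 \<and> L \<in> SO_cal \<omega>}"


section \<open>Weak differentials and local Sobolev spaces\<close>

text \<open>For finite-dimensional domains, \<open>Ck k f\<close> says that \<open>f\<close> is \<open>k\<close> times continuously differentiable.\<close>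

primrec Ck :: "nat \<Rightarrow> ('a::euclidean_space \<Rightarrow> 'b::real_normed_vector) \<Rightarrow> bool" where
  "Ck 0 f \<longleftrightarrow> continuous_on UNIV f"
| "Ck (Suc k) f \<longleftrightarrow>
     (\<forall>x. f differentiable (at x)) \<and> (\<forall>v. Ck k (\<lambda>x. frechet_derivative f (at x) v))"

definition test_function :: "'a::euclidean_space set \<Rightarrow> ('a \<Rightarrow> real) \<Rightarrow> bool" where
  "test_function \<Omega> \<phi> \<longleftrightarrow>
     (\<forall>k. Ck k \<phi>) \<and> compact (closure {x. \<phi> x \<noteq> 0}) \<and> closure {x. \<phi> x \<noteq> 0} \<subseteq> \<Omega>"

definition Lp_loc :: "nat \<Rightarrow> 'a::euclidean_space set \<Rightarrow> ('a \<Rightarrow> 'b::euclidean_space) \<Rightarrow> bool" where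
  "Lp_loc p \<Omega> f \<longleftrightarrow>
     f \<in> borel_measurable (lebesgue_on \<Omega>) \<and>
     (\<forall>K. compact K \<and> K \<subseteq> \<Omega> \<longrightarrow> integrable (lebesgue_on K) (\<lambda>x. norm (f x) ^ p))"

definition has_weak_differential ::
  "('a::euclidean_space \<Rightarrow> 'b::euclidean_space) \<Rightarrow> ('a \<Rightarrow> 'a \<Rightarrow> 'b) \<Rightarrow> 'a set \<Rightarrow> bool" where
  "has_weak_differential F D \<Omega> \<longleftrightarrow>
     Lp_loc 1 \<Omega> F \<and> (\<forall>x. linear (D x)) \<and> (\<forall>v. Lp_loc 1 \<Omega> (\<lambda>x. D x v)) \<and>
     (\<forall>\<phi> v. test_function \<Omega> \<phi> \<longrightarrow>
        (LINT x|lebesgue_on \<Omega>. frechet_derivative \<phi> (at x) v *\<^sub>R F x) =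
        - (LINT x|lebesgue_on \<Omega>. \<phi> x *\<^sub>R D x v))"

text \<open>
  A weak differential on an open set is unique up to a null set, so it should only be used in
  statements that hold almost everywhere.
\<close>

definition weak_differential ::
  "'a::euclidean_space set \<Rightarrow> ('a \<Rightarrow> 'b::euclidean_space) \<Rightarrow> 'a \<Rightarrow> 'a \<Rightarrow> 'b" where
  "weak_differential \<Omega> F = (SOME D. has_weak_differential F D \<Omega>)"

definition W1p_loc :: "nat \<Rightarrow> 'a::euclidean_space set \<Rightarrow> ('a \<Rightarrow> 'b::euclidean_space) \<Rightarrow> bool" where
  "W1p_loc p \<Omega> F \<longleftrightarrow>
     Lp_loc p \<Omega> F \<and>
     (\<exists>D. has_weak_differential F D \<Omega> \<and> (\<forall>v. Lp_loc p \<Omega> (\<lambda>x. D x v)))"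


section \<open>Conformal curves\<close>

text \<open>
  A conformal \<open>\<omega>\<close>-curve is identified with its continuous representative. Only continuity of the
  representative is built in; continuous differentiability is not.
\<close>

definition conformal_curve ::
  "(('n::finite \<Rightarrow> real^'m::finite) \<Rightarrow> real) \<Rightarrow> (real^'n) set \<Rightarrow> (real^'n \<Rightarrow> real^'m) \<Rightarrow> bool" where
  "conformal_curve \<omega> \<Omega> F \<longleftrightarrow>
     continuous_on \<Omega> F \<and> W1p_loc CARD('n) \<Omega> F \<and>
     (AE x in lebesgue_on \<Omega>. weak_differential \<Omega> F x \<in> CO_cal \<omega>)"

text \<open>\<open>F\<close> need only be meaningful on \<open>\<Omega>\<close>, so affineness is required there only.\<close>

definition affine_map_on ::
  "'a::real_vector set \<Rightarrow> ('a \<Rightarrow> 'b::real_vector) \<Rightarrow> bool" where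
  "affine_map_on \<Omega> F \<longleftrightarrow> (\<exists>A b. linear A \<and> (\<forall>x\<in>\<Omega>. F x = A x + b))"

end

theory Submission
  imports Defs
begin

text \<open>
  Suppose that \<open>DF = c L\<close> with \<open>L \<in> SO(\<omega>)\<close> almost everywhere. Since \<open>\<omega>\<close> has comass one, the functional
  \<open>w \<mapsto> \<omega>(L e\<^sub>1, \<dots>, w, \<dots>, L e\<^sub>n)\<close> with \<open>w\<close> in slot \<open>i\<close> is represented by \<open>L e\<^sub>i\<close>, so that
  \<open>c\<^sup>n\<^sup>-\<^sup>2 \<partial>\<^sub>iF \<bullet> w = \<omega>(\<partial>\<^sub>1F, \<dots>, w, \<dots>, \<partial>\<^sub>nF)\<close>. The right-hand side is a divergence-free field in \<open>i\<close>, which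
  is seen by mollifying \<open>F\<close>; hence \<open>F\<close> is weakly harmonic. For a mollification \<open>F\<^sub>\<epsilon>\<close> the Bochner
  identity reads \<open>2 \<integral> \<psi> |\<nabla>\<partial>\<^sub>kF\<^sub>\<epsilon>|\<^sup>2 = \<integral> \<Delta>\<psi> |\<partial>\<^sub>kF\<^sub>\<epsilon>|\<^sup>2\<close>. As \<open>\<epsilon> \<rightarrow> 0\<close> the right-hand side tends to
  \<open>c\<^sup>2 \<integral> \<Delta>\<psi> = 0\<close>, so the weak Hessian of \<open>F\<close> vanishes and \<open>F\<close> is locally affine. Conversely, the
  weak differential of an affine map is almost everywhere its linear part.
\<close>

section \<open>Smooth functions and bump functions\<close>

text \<open>The two ingredients live on different levels. The cofactor identity and the constant
  length of the partials hold for \<open>F\<close> itself, whereas second and third derivatives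
  exist only for a mollification, whose differential need no longer be conformal. Identities are
  therefore computed for mollifications and passed to the limit after pairing with a fixed test
  function; the bound \<open>c\<close> on the partials supplies the dominating function. Constancy
  of \<open>c\<close> enters twice: the factor c^(n-2) can be taken out of the divergence (with
  variable dilation the same formal computation gives the n-harmonic equation instead), and the
  limit of the Bochner identity becomes an integral of second derivatives of a test function. The
  weak Hessian of \<open>F\<close> being zero, testing it with reflected mollifiers shows that each
  mollification at small scale has Hessian exactly zero on a smaller ball. Thus \<open>F\<close> is
  locally a pointwise limit of affine maps, and no elliptic regularity is invoked.\<close>

definition dird :: "'a::euclidean_space \<Rightarrow> ('a \<Rightarrow> 'b::real_normed_vector) \<Rightarrow> 'a \<Rightarrow> 'b" where
  "dird v f x = frechet_derivative f (at x) v"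

lemma dird_eqI: "(f has_derivative f') (at x) \<Longrightarrow> dird v f x = f' v"
  unfolding dird_def using frechet_derivative_at by metis

lemma Ck_Suc_iff: "Ck (Suc k) f \<longleftrightarrow> (\<forall>x. f differentiable (at x)) \<and> (\<forall>v. Ck k (dird v f))"
  by (simp add: dird_def[abs_def])

lemma Ck_SucI:
  assumes "\<And>x. (f has_derivative (\<lambda>v. f' v x)) (at x)" "\<And>v. Ck k (f' v)"
  shows "Ck (Suc k) f"
proof -
  have "dird v f = f' v" for v using dird_eqI[OF assms(1)] by fastforce
  then show ?thesis unfolding Ck_Suc_iff using assms by (auto simp: differentiable_def)
qed

lemma Ck_has_derivative: "Ck (Suc k) f \<Longrightarrow> (f has_derivative (\<lambda>v. dird v f x)) (at x)"
  by (simp add: dird_def[abs_def] frechet_derivative_works[symmetric])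

lemma Ck_SucD: "Ck (Suc k) f \<Longrightarrow> Ck k f"
proof (induction k arbitrary: f)
  case 0
  then show ?case
    by (simp add: differentiable_imp_continuous_on differentiable_at_withinI differentiable_on_def)
next
  case (Suc k)
  then show ?case unfolding Ck_Suc_iff by auto
qed

lemma Ck_continuous: "Ck k f \<Longrightarrow> continuous_on UNIV f"
  by (induction k) (auto dest: Ck_SucD simp del: Ck.simps(2))

lemma Ck_const: "Ck k (\<lambda>x. c)"
proof (induction k arbitrary: c)
  case (Suc k)
  show ?case by (rule Ck_SucI[where f' = "\<lambda>_ _. 0"]) (auto simp: Suc)
qed auto

lemma Ck_add: "Ck k f \<Longrightarrow> Ck k g \<Longrightarrow> Ck k (\<lambda>x. f x + g x)"
proof (induction k arbitrary: f g)
  case (Suc k)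
  show ?case
    by (rule Ck_SucI[where f' = "\<lambda>v x. dird v f x + dird v g x"])
      (use Suc in \<open>auto intro!: derivative_intros Ck_has_derivative simp: Ck_Suc_iff simp del: Ck.simps(2)\<close>)
qed (auto intro: continuous_intros)

lemma Ck_mult:
  fixes f g :: "'a::euclidean_space \<Rightarrow> real"
  shows "Ck k f \<Longrightarrow> Ck k g \<Longrightarrow> Ck k (\<lambda>x. f x * g x)"
proof (induction k arbitrary: f g)
  case (Suc k)
  show ?case
  proof (rule Ck_SucI[where f' = "\<lambda>v x. f x * dird v g x + dird v f x * g x"])
    show "((\<lambda>x. f x * g x) has_derivative (\<lambda>v. f x * dird v g x + dird v f x * g x)) (at x)" for x
      by (intro has_derivative_mult Ck_has_derivative[OF Suc.prems(1)] Ck_has_derivative[OF Suc.prems(2)])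
    show "Ck k (\<lambda>x. f x * dird v g x + dird v f x * g x)" for v
      using Suc.prems Suc.prems[THEN Ck_SucD]
      by (intro Ck_add Suc.IH) (auto simp: Ck_Suc_iff simp del: Ck.simps(2))
  qed
qed (auto intro: continuous_intros)

lemma Ck_compose_affine:
  "Ck k f \<Longrightarrow> Ck k (\<lambda>x. f (a + s *\<^sub>R x))"
proof (induction k arbitrary: f)
  case 0
  then show ?case by (auto intro!: continuous_on_compose2[of UNIV f] continuous_intros)
next
  case (Suc k)
  show ?case
  proof (rule Ck_SucI[where f' = "\<lambda>v x. dird (s *\<^sub>R v) f (a + s *\<^sub>R x)"])
    show "((\<lambda>x. f (a + s *\<^sub>R x)) has_derivative (\<lambda>v. dird (s *\<^sub>R v) f (a + s *\<^sub>R x))) (at x)" for x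
      by (rule has_derivative_compose[of "\<lambda>x. a + s *\<^sub>R x" "\<lambda>v. s *\<^sub>R v" x UNIV f "\<lambda>v. dird v f (a + s *\<^sub>R x)"])
        (auto intro!: derivative_eq_intros Ck_has_derivative[OF Suc.prems])
    show "Ck k (\<lambda>x. dird (s *\<^sub>R v) f (a + s *\<^sub>R x))" for v
      using Suc.prems by (intro Suc.IH) (auto simp: Ck_Suc_iff simp del: Ck.simps(2))
  qed
qed

text \<open>The whole sequence of derivatives of the outer function is an input because the chain
  rule turns \<open>h j\<close> into \<open>h (Suc j)\<close>; the induction on \<open>k\<close>
  closes only with \<open>j\<close> arbitrary.\<close>

lemma Ck_compose_real:
  fixes h :: "nat \<Rightarrow> real \<Rightarrow> real" and f :: "'a::euclidean_space \<Rightarrow> real"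
  assumes h: "\<And>j t. (h j has_real_derivative h (Suc j) t) (at t)"
  shows "Ck k f \<Longrightarrow> Ck k (\<lambda>x. h j (f x))"
proof (induction k arbitrary: j)
  case 0
  have "continuous_on UNIV (h j)"
    using h by (meson DERIV_isCont continuous_at_imp_continuous_on)
  with 0 show ?case by (auto intro!: continuous_on_compose2[of UNIV "h j"])
next
  case (Suc k)
  show ?case
  proof (rule Ck_SucI[where f' = "\<lambda>v x. h (Suc j) (f x) * dird v f x"])
    show "((\<lambda>x. h j (f x)) has_derivative (\<lambda>v. h (Suc j) (f x) * dird v f x)) (at x)" for x
      by (rule has_derivative_compose[OF Ck_has_derivative[OF Suc.prems]])
        (use h in \<open>simp add: has_field_derivative_def\<close>)
    show "Ck k (\<lambda>x. h (Suc j) (f x) * dird v f x)" for v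
      using Suc.prems Suc.prems[THEN Ck_SucD]
      by (intro Ck_mult Suc.IH) (auto simp: Ck_Suc_iff simp del: Ck.simps(2))
  qed
qed

section \<open>Ingredients of the bump: inner products and the flat function exp(-1/t)\<close>

lemma Ck_inner_left: "Ck k (\<lambda>x. (x - a) \<bullet> v)"
proof (cases k)
  case (Suc j)
  show ?thesis unfolding Suc
    by (rule Ck_SucI[where f' = "\<lambda>u x. u \<bullet> v"]) (auto intro!: derivative_eq_intros Ck_const)
qed (auto intro!: continuous_intros)

lemma Ck_inner_self: "Ck k (\<lambda>x. (x - a) \<bullet> (x - a))"
proof (cases k)
  case (Suc j)
  have "((\<lambda>x. (x - a) \<bullet> (x - a)) has_derivative (\<lambda>u. (x - a) \<bullet> u + (x - a) \<bullet> u)) (at x)" for x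
    by (rule derivative_eq_intros refl)+ (simp add: inner_commute)
  then show ?thesis unfolding Suc
    by (rule Ck_SucI[where f' = "\<lambda>u x. (x - a) \<bullet> u + (x - a) \<bullet> u"])
      (intro Ck_add Ck_inner_left)
qed (auto intro!: continuous_intros)

text \<open>With s = 1/t, the derivative in t of p(s) exp(-s) is s^2 (p(s) - p'(s)) exp(-s); the
  recursion records this polynomial factor.\<close>

primrec bump_poly :: "nat \<Rightarrow> real poly" where
  "bump_poly 0 = 1"
| "bump_poly (Suc j) = [:0, 0, 1:] * (bump_poly j - pderiv (bump_poly j))"

text \<open>The \<open>j\<close>-th derivative of \<open>exp (-1/t)\<close>, extended by \<open>0\<close> to \<open>t \<le> 0\<close>.\<close>

definition bump_fun :: "nat \<Rightarrow> real \<Rightarrow> real" where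
  "bump_fun j t = (if t \<le> 0 then 0 else poly (bump_poly j) (1 / t) * exp (- (1 / t)))"

lemma poly_times_exp_tendsto_0: "((\<lambda>s::real. poly p s * exp (- s)) \<longlongrightarrow> 0) at_top"
proof -
  have "((\<lambda>s::real. \<Sum>i\<le>degree p. coeff p i * (s ^ i / exp s)) \<longlongrightarrow> (\<Sum>i\<le>degree p. coeff p i * 0)) at_top"
    by (intro tendsto_intros tendsto_power_div_exp_0)
  then show ?thesis
    by (simp add: poly_altdef sum_distrib_right exp_minus divide_inverse mult.assoc)
qed

lemma bump_fun_deriv: "(bump_fun j has_real_derivative bump_fun (Suc j) t) (at t)"
proof -
  consider "t < 0" | "t > 0" | "t = 0" by linarith
  then show ?thesis
  proof cases
    case 1
    have "(bump_fun j has_real_derivative 0) (at t)"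
      by (rule has_field_derivative_transform_within[where f = "\<lambda>_. 0" and d = "-t"])
         (use 1 in \<open>auto simp: bump_fun_def dist_real_def\<close>)
    then show ?thesis using 1 by (simp add: bump_fun_def)
  next
    case 2
    have "((\<lambda>t. poly (bump_poly j) (1 / t) * exp (- (1 / t))) has_real_derivative bump_fun (Suc j) t) (at t)"
      using 2 by (auto intro!: derivative_eq_intros DERIV_chain'[OF _ poly_DERIV]
          simp: bump_fun_def field_simps power2_eq_square)
    then show ?thesis
      by (rule has_field_derivative_transform_within[where d = t]) (use 2 in \<open>auto simp: bump_fun_def dist_real_def\<close>)
  next
    case 3
    \<comment> \<open>With s = 1/t, the right difference quotient at 0 is s p(s) exp(-s); the extra
      factor s is the polynomial \<open>[:0,1:]\<close>.\<close>
    have "((\<lambda>s. poly ([:0,1:] * bump_poly j) s * exp (- s)) \<longlongrightarrow> 0) at_top"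
      by (rule poly_times_exp_tendsto_0)
    then have "((\<lambda>t. poly ([:0,1:] * bump_poly j) (inverse t) * exp (- inverse t)) \<longlongrightarrow> 0) (at_right 0)"
      by (rule filterlim_compose) (rule filterlim_inverse_at_top_right)
    moreover have "eventually (\<lambda>t. poly ([:0,1:] * bump_poly j) (inverse t) * exp (- inverse t)
        = (bump_fun j t - bump_fun j 0) / (t - 0)) (at_right 0)"
      unfolding eventually_at_right_field
      by (intro exI[of _ 1]) (auto simp: bump_fun_def field_simps)
    ultimately have R: "((\<lambda>t. (bump_fun j t - bump_fun j 0) / (t - 0)) \<longlongrightarrow> 0) (at_right 0)"
      using tendsto_cong by fast
    have L: "((\<lambda>t. (bump_fun j t - bump_fun j 0) / (t - 0)) \<longlongrightarrow> 0) (at_left 0)"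
      by (rule tendsto_eventually)
        (auto simp: eventually_at_left_field bump_fun_def intro!: exI[of _ "-1"])
    have "(bump_fun j has_real_derivative 0) (at 0)"
      unfolding has_field_derivative_iff using L R by (simp add: filterlim_at_split)
    then show ?thesis using 3 by (simp add: bump_fun_def)
  qed
qed

section \<open>Test functions and convolution\<close>

lemma test_function_Ck: "test_function \<Omega> \<phi> \<Longrightarrow> Ck k \<phi>"
  by (auto simp: test_function_def)

lemma test_function_has_derivative:
  "test_function \<Omega> \<phi> \<Longrightarrow> (\<phi> has_derivative (\<lambda>v. dird v \<phi> x)) (at x)"
  using Ck_has_derivative test_function_Ck by blast

lemma test_function_continuous: "test_function \<Omega> \<phi> \<Longrightarrow> continuous_on UNIV \<phi>"
  using Ck_continuous test_function_Ck by blast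

lemma dird_eq_0:
  assumes "open S" "x \<in> S" "\<And>y. y \<in> S \<Longrightarrow> f y = 0"
  shows "dird v f x = 0"
proof -
  have "(f has_derivative (\<lambda>_. 0)) (at x)"
    by (rule has_derivative_transform_within_open[where f = "\<lambda>_. 0", OF _ assms(1,2)])
      (use assms in auto)
  then show ?thesis by (rule dird_eqI)
qed

lemma test_function_dird:
  assumes "test_function \<Omega> \<phi>"
  shows "test_function \<Omega> (dird v \<phi>)"
proof -
  let ?K = "closure {x. \<phi> x \<noteq> 0}"
  have "dird v \<phi> x = 0" if "x \<notin> ?K" for x
    by (rule dird_eq_0[where S = "- ?K"]) (use that closure_subset[of "{x. \<phi> x \<noteq> 0}"] in auto)
  then have "closure {x. dird v \<phi> x \<noteq> 0} \<subseteq> ?K"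
    by (intro closure_minimal) auto
  moreover have "Ck k (dird v \<phi>)" for k
    using test_function_Ck[OF assms, of "Suc k"] by (auto simp: Ck_Suc_iff simp del: Ck.simps(2))
  ultimately show ?thesis using assms bounded_subset[of ?K]
    by (auto simp: test_function_def compact_eq_bounded_closed)
qed

lemma outside_support: "x \<notin> closure {x. \<phi> x \<noteq> 0} \<Longrightarrow> \<phi> x = 0"
  using closure_subset[of "{x. \<phi> x \<noteq> 0}"] by blast

lemma test_function_mono: "test_function \<Omega> \<phi> \<Longrightarrow> \<Omega> \<subseteq> \<Omega>' \<Longrightarrow> test_function \<Omega>' \<phi>"
  unfolding test_function_def by blast

lemma test_functionI:
  assumes "\<And>k. Ck k \<phi>" "compact K" "K \<subseteq> \<Omega>" "\<And>x. x \<notin> K \<Longrightarrow> \<phi> x = 0"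
  shows "test_function \<Omega> \<phi>"
proof -
  have "closure {x. \<phi> x \<noteq> 0} \<subseteq> K"
    using assms by (intro closure_minimal) (auto simp: compact_imp_closed)
  then show ?thesis using assms bounded_subset[of K]
    by (auto simp: test_function_def compact_eq_bounded_closed)
qed

lemma continuous_compact_support_bounded:
  fixes f :: "'a::euclidean_space \<Rightarrow> 'b::real_normed_vector"
  assumes "continuous_on UNIV f" "compact K" "\<And>x. x \<notin> K \<Longrightarrow> f x = 0"
  obtains M where "M \<ge> 0" "\<And>x. norm (f x) \<le> M"
proof -
  have "compact (f ` K)"
    using assms by (auto intro!: compact_continuous_image intro: continuous_on_subset)
  then obtain M where M: "\<And>y. y \<in> f ` K \<Longrightarrow> norm y \<le> M"
    using compact_imp_bounded bounded_iff by metis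
  have "norm (f x) \<le> max M 0" for x
    using M[of "f x"] assms(3)[of x] by (cases "x \<in> K") auto
  then show ?thesis using that[of "max M 0"] by auto
qed

lemma continuous_compact_support_integrable:
  fixes f :: "'a::euclidean_space \<Rightarrow> 'b::euclidean_space"
  assumes "continuous_on UNIV f" "compact K" "\<And>x. x \<notin> K \<Longrightarrow> f x = 0"
  shows "integrable lborel f" "integrable lebesgue f"
proof -
  have "integrable lborel (\<lambda>x. indicator K x *\<^sub>R f x)"
    using assms by (intro borel_integrable_compact) (auto intro: continuous_on_subset)
  also have "(\<lambda>x. indicator K x *\<^sub>R f x) = f"
    using assms(3) by (auto simp: indicator_def fun_eq_iff)
  finally show "integrable lborel f" .
  then show "integrable lebesgue f"
    by (subst integrable_completion) (auto dest: borel_measurable_integrable)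
qed

lemma test_function_bounded:
  assumes "test_function \<Omega> \<phi>"
  obtains M where "M \<ge> 0" "\<And>x. \<bar>\<phi> x\<bar> \<le> M"
proof (rule continuous_compact_support_bounded[OF test_function_continuous[OF assms]])
  show "compact (closure {x. \<phi> x \<noteq> 0})" using assms by (simp add: test_function_def)
  show "\<phi> x = 0" if "x \<notin> closure {x. \<phi> x \<noteq> 0}" for x using that by (rule outside_support)
qed (use that in auto)

text \<open>The constant is uniform in the base point, so the remainder can be integrated against
  any integrable function. It comes from bounded second directional derivatives along basis vectors;
  no attempt is made to get the sharp factor 1/2.\<close>

lemma test_function_Taylor:
  assumes "test_function \<Omega> \<phi>"
  obtains C where "C \<ge> 0" "\<And>x h. \<bar>\<phi> (x + h) - \<phi> x - dird h \<phi> x\<bar> \<le> C * (norm h)\<^sup>2"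
proof -
  have "\<exists>M. M \<ge> 0 \<and> (\<forall>x. \<bar>dird a (dird b \<phi>) x\<bar> \<le> M)" for a b
    using test_function_bounded[OF test_function_dird[OF test_function_dird[OF assms]]] by metis
  then obtain M where M: "\<And>a b. M a b \<ge> 0" "\<And>a b x. \<bar>dird a (dird b \<phi>) x\<bar> \<le> M a b"
    by metis
  have lin: "linear (\<lambda>v. dird v \<phi> x)" for x
    using test_function_has_derivative[OF assms] has_derivative_linear by blast
  have lin2: "linear (\<lambda>v. dird v (dird b \<phi>) x)" for x b
    using test_function_has_derivative[OF test_function_dird[OF assms]] has_derivative_linear by blast
  have expand: "dird v \<phi> x = (\<Sum>b\<in>Basis. (v \<bullet> b) * dird b \<phi> x)" for v x
    using linear_sum[OF lin, of "\<lambda>b. (v \<bullet> b) *\<^sub>R b" Basis] linear_scale[OF lin]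
    by (simp add: euclidean_representation)
  have expand2: "dird v (dird b \<phi>) x = (\<Sum>a\<in>Basis. (v \<bullet> a) * dird a (dird b \<phi>) x)" for v x b
    using linear_sum[OF lin2, of "\<lambda>b. (v \<bullet> b) *\<^sub>R b" Basis] linear_scale[OF lin2]
    by (simp add: euclidean_representation)
  define L where "L b = (\<Sum>a\<in>Basis. M a b)" for b
  have L: "\<bar>dird v (dird b \<phi>) x\<bar> \<le> L b * norm v" for v b x
    unfolding expand2[of v] L_def sum_distrib_right
    by (intro sum_abs[THEN order_trans] sum_mono)
      (simp add: abs_mult mult.commute[of "M _ _"] mult_mono M Basis_le_norm)
  have lip: "\<bar>dird b \<phi> y - dird b \<phi> x\<bar> \<le> L b * norm (y - x)" for b x y
  proof -
    have "norm (dird b \<phi> y - dird b \<phi> x) \<le> L b * norm (y - x)"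
    proof (rule differentiable_bound[of UNIV "dird b \<phi>" "\<lambda>x v. dird v (dird b \<phi>) x"])
      show "onorm (\<lambda>v. dird v (dird b \<phi>) z) \<le> L b" if "z \<in> UNIV" for z
        by (rule onorm_le) (simp add: L)
    qed (use test_function_has_derivative[OF test_function_dird[OF assms]] in auto)
    then show ?thesis by simp
  qed
  define C where "C = (\<Sum>b\<in>Basis. L b)"
  have lip': "\<bar>dird v \<phi> y - dird v \<phi> x\<bar> \<le> C * norm (y - x) * norm v" for v x y
  proof -
    have "\<bar>dird v \<phi> y - dird v \<phi> x\<bar> = \<bar>\<Sum>b\<in>Basis. (v \<bullet> b) * (dird b \<phi> y - dird b \<phi> x)\<bar>"
      unfolding expand[of v] by (simp add: sum_subtractf right_diff_distrib)
    also have "\<dots> \<le> (\<Sum>b\<in>Basis. norm v * (L b * norm (y - x)))"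
      by (intro sum_abs[THEN order_trans] sum_mono)
        (simp add: abs_mult mult_mono Basis_le_norm lip)
    also have "\<dots> = C * norm (y - x) * norm v"
      by (simp add: C_def sum_distrib_left sum_distrib_right mult_ac)
    finally show ?thesis .
  qed
  have "L b \<ge> 0" for b unfolding L_def by (intro sum_nonneg M)
  then have C0: "C \<ge> 0" unfolding C_def by (intro sum_nonneg)
  have "\<bar>\<phi> (x + h) - \<phi> x - dird h \<phi> x\<bar> \<le> C * (norm h)\<^sup>2" for x h
  proof -
    \<comment> \<open>Mean value inequality on the ball of radius |h|, where the differential varies
      by at most C |h|.\<close>
    have "norm (\<phi> (x + h) - \<phi> x - dird (x + h - x) \<phi> x) \<le> norm (x + h - x) * (C * norm h)"
    proof (rule differentiable_bound_linearization[where S = "cball x (norm h)" and f' = "\<lambda>x v. dird v \<phi> x"])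
      show "x + t *\<^sub>R (x + h - x) \<in> cball x (norm h)" if "t \<in> {0..1}" for t
        using that by (auto simp: dist_norm mult_left_le_one_le)
      show "(\<phi> has_derivative (\<lambda>v. dird v \<phi> y)) (at y within cball x (norm h))" for y
        using test_function_has_derivative[OF assms] has_derivative_at_withinI by blast
      show "onorm ((\<lambda>i. dird i \<phi> y) - (\<lambda>i. dird i \<phi> x)) \<le> C * norm h" if "y \<in> cball x (norm h)" for y
        unfolding fun_diff_def
      proof (rule onorm_le)
        fix v
        have "norm (dird v \<phi> y - dird v \<phi> x) \<le> C * norm (y - x) * norm v" using lip' by simp
        also have "\<dots> \<le> C * norm h * norm v"
          using that C0 by (intro mult_right_mono mult_left_mono) (auto simp: dist_norm norm_minus_commute)
        finally show "norm (dird v \<phi> y - dird v \<phi> x) \<le> C * norm h * norm v" .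
      qed
    qed auto
    then show ?thesis by (simp add: power2_eq_square mult_ac)
  qed
  with C0 show ?thesis by (rule that)
qed

section \<open>Convolution of an integrable function with a test function\<close>

definition conv :: "('a::euclidean_space \<Rightarrow> real) \<Rightarrow> ('a \<Rightarrow> 'b::euclidean_space) \<Rightarrow> 'a \<Rightarrow> 'b" where
  "conv \<phi> f x = (LINT y|lebesgue. \<phi> (x - y) *\<^sub>R f y)"

lemma continuous_borel_lebesgue: "continuous_on UNIV f \<Longrightarrow> f \<in> borel_measurable lebesgue"
  by (simp add: borel_measurable_continuous_onI measurable_completion)

lemma integrable_bounded_scaleR:
  fixes f :: "'a::euclidean_space \<Rightarrow> 'b::euclidean_space"
  assumes "integrable lebesgue f" "\<phi> \<in> borel_measurable lebesgue" "\<And>x. \<bar>\<phi> x\<bar> \<le> M"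
  shows "integrable lebesgue (\<lambda>x. \<phi> x *\<^sub>R f x)"
proof (rule Bochner_Integration.integrable_bound)
  show "integrable lebesgue (\<lambda>x. M *\<^sub>R f x)" using assms by simp
  show "AE x in lebesgue. norm (\<phi> x *\<^sub>R f x) \<le> norm (M *\<^sub>R f x)"
    using assms(3) abs_ge_self[of M] by (intro AE_I2) (auto intro!: mult_right_mono intro: order_trans)
qed (use assms in auto)

lemma conv_integrable:
  fixes f :: "'a::euclidean_space \<Rightarrow> 'b::euclidean_space"
  assumes "test_function \<Omega> \<phi>" "integrable lebesgue f"
  shows "integrable lebesgue (\<lambda>y. \<phi> (x - y) *\<^sub>R f y)"
proof -
  obtain M where "\<And>x. \<bar>\<phi> x\<bar> \<le> M" using test_function_bounded[OF assms(1)] by metis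
  moreover have "continuous_on UNIV (\<lambda>y. \<phi> (x - y))"
    by (rule continuous_on_compose2[OF test_function_continuous[OF assms(1)]]) (auto intro!: continuous_intros)
  ultimately show ?thesis
    using assms(2) by (intro integrable_bounded_scaleR[where M = M] continuous_borel_lebesgue) auto
qed

text \<open>All differentiation falls on the kernel, so \<open>f\<close> need only be integrable:
  integrating the uniform Taylor remainder against |f| leaves an error of order |h|^2.\<close>

lemma conv_has_derivative:
  fixes f :: "'a::euclidean_space \<Rightarrow> 'b::euclidean_space"
  assumes "test_function \<Omega> \<phi>" "integrable lebesgue f"
  shows "(conv \<phi> f has_derivative (\<lambda>v. conv (dird v \<phi>) f x)) (at x)"
proof -
  have lin: "linear (\<lambda>v. dird v \<phi> x)" for x
    using test_function_has_derivative[OF assms(1)] has_derivative_linear by blast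
  note I = conv_integrable[OF assms] conv_integrable[OF test_function_dird[OF assms(1)] assms(2)]
  have linc: "linear (\<lambda>v. conv (dird v \<phi>) f x)"
  proof (rule linearI)
    fix u v :: 'a and r :: real
    show "conv (dird (u + v) \<phi>) f x = conv (dird u \<phi>) f x + conv (dird v \<phi>) f x"
      unfolding conv_def linear_add[OF lin] scaleR_add_left
      by (rule Bochner_Integration.integral_add[OF I(2) I(2)])
    show "conv (dird (r *\<^sub>R v) \<phi>) f x = r *\<^sub>R conv (dird v \<phi>) f x"
      unfolding conv_def linear_scale[OF lin] by (simp flip: scaleR_scaleR)
  qed
  obtain C where C: "C \<ge> 0" "\<And>x h. \<bar>\<phi> (x + h) - \<phi> x - dird h \<phi> x\<bar> \<le> C * (norm h)\<^sup>2"
    using test_function_Taylor[OF assms(1)] by blast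
  define A where "A = (LINT y|lebesgue. norm (f y))"
  have A: "A \<ge> 0" unfolding A_def by simp
  have B: "norm (conv \<phi> f (x + h) - conv \<phi> f x - conv (dird h \<phi>) f x) \<le> (C * A * norm h) * norm h" for h
  proof -
    have xh: "x + h - y = x - y + h" for y by simp
    have eq: "conv \<phi> f (x + h) - conv \<phi> f x - conv (dird h \<phi>) f x
        = (LINT y|lebesgue. (\<phi> ((x - y) + h) - \<phi> (x - y) - dird h \<phi> (x - y)) *\<^sub>R f y)"
      unfolding conv_def scaleR_diff_left xh[symmetric]
      using Bochner_Integration.integral_diff[OF Bochner_Integration.integrable_diff[OF I(1)[of "x + h"] I(1)[of x]] I(2)[of h x]]
        Bochner_Integration.integral_diff[OF I(1)[of "x + h"] I(1)[of x]] by simp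
    have int: "integrable lebesgue (\<lambda>y. (\<phi> ((x - y) + h) - \<phi> (x - y) - dird h \<phi> (x - y)) *\<^sub>R f y)"
      unfolding scaleR_diff_left xh[symmetric]
      by (intro Bochner_Integration.integrable_diff I)
    have "norm (conv \<phi> f (x + h) - conv \<phi> f x - conv (dird h \<phi>) f x)
        \<le> (LINT y|lebesgue. norm ((\<phi> ((x - y) + h) - \<phi> (x - y) - dird h \<phi> (x - y)) *\<^sub>R f y))"
      unfolding eq by (rule integral_norm_bound)
    also have "\<dots> \<le> (LINT y|lebesgue. (C * (norm h)\<^sup>2) * norm (f y))"
      using assms(2) C int by (intro integral_mono integrable_norm) (auto intro!: mult_right_mono)
    finally show ?thesis by (simp add: A_def power2_eq_square mult_ac)
  qed

  show ?thesis
    unfolding has_derivative_at_alt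
  proof (intro conjI allI impI)
    show "bounded_linear (\<lambda>v. conv (dird v \<phi>) f x)" using linc by (rule linear_conv_bounded_linear[THEN iffD1])
    fix e :: real assume e: "e > 0"
    \<comment> \<open>The summand 1 keeps the denominator positive when \<open>C * A\<close> is
      0.\<close>
    define d where "d = e / (C * A + 1)"
    have pos: "C * A + 1 > 0" using C A by (simp add: add_nonneg_pos)
    have "norm (conv \<phi> f y - conv \<phi> f x - conv (dird (y - x) \<phi>) f x) \<le> e * norm (y - x)"
      if "norm (y - x) < d" for y
    proof -
      have "C * A * norm (y - x) \<le> (C * A + 1) * d"
        using that C A by (intro mult_mono) auto
      also have "\<dots> = e" using pos by (simp add: d_def)
      finally show ?thesis using B[of "y - x"] mult_right_mono[of "C * A * norm (y - x)" e "norm (y - x)"] by simp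
    qed
    moreover have "d > 0" using e pos by (simp add: d_def)
    ultimately show "\<exists>d>0. \<forall>y. norm (y - x) < d \<longrightarrow>
        norm (conv \<phi> f y - conv \<phi> f x - conv (dird (y - x) \<phi>) f x) \<le> e * norm (y - x)" by blast
  qed
qed

lemma conv_continuous:
  fixes f :: "'a::euclidean_space \<Rightarrow> 'b::euclidean_space"
  assumes "test_function \<Omega> \<phi>" "integrable lebesgue f"
  shows "continuous_on UNIV (conv \<phi> f)"
  using has_derivative_continuous[OF conv_has_derivative[OF assms]]
  by (intro continuous_at_imp_continuous_on) blast

section \<open>Integration by parts\<close>

text \<open>A convolution at \<open>x\<close> is a pairing with the reflected kernel. Once that
  kernel is a test function on the set, the weak identities assumed there apply to the
  convolution.\<close>

lemma test_function_reflect: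
  assumes "test_function \<Omega>' \<phi>" "compact K" "\<And>z. z \<notin> K \<Longrightarrow> \<phi> z = 0" "\<And>z. z \<in> K \<Longrightarrow> x - z \<in> \<Omega>"
  shows "test_function \<Omega> (\<lambda>y. \<phi> (x - y))"
proof (rule test_functionI)
  show "Ck k (\<lambda>y. \<phi> (x - y))" for k
    using Ck_compose_affine[OF test_function_Ck[OF assms(1)], of k x "-1"] by simp
  show "compact ((\<lambda>z. x - z) ` K)"
    using assms(2) by (auto intro!: compact_continuous_image continuous_intros)
  show "(\<lambda>z. x - z) ` K \<subseteq> \<Omega>" using assms(4) by auto
  show "\<phi> (x - y) = 0" if "y \<notin> (\<lambda>z. x - z) ` K" for y
  proof (rule assms(3), rule)
    assume "x - y \<in> K"
    then have "x - (x - y) \<in> (\<lambda>z. x - z) ` K" by (rule imageI)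
    with that show False by simp
  qed
qed

lemma dird_reflect:
  assumes "test_function \<Omega> \<phi>"
  shows "dird v (\<lambda>y. \<phi> (x - y)) y = - dird v \<phi> (x - y)"
proof -
  have lin: "linear (\<lambda>v. dird v \<phi> z)" for z
    using test_function_has_derivative[OF assms] has_derivative_linear by blast
  have "((\<lambda>y. \<phi> (x - y)) has_derivative (\<lambda>v. dird (- v) \<phi> (x - y))) (at y)"
    by (rule has_derivative_compose[of "\<lambda>y. x - y" "\<lambda>v. - v" y UNIV \<phi> "\<lambda>v. dird v \<phi> (x - y)"])
      (auto intro!: derivative_eq_intros test_function_has_derivative[OF assms])
  from dird_eqI[OF this] show ?thesis by (simp add: linear_neg[OF lin])
qed

text \<open>For s > 0 and C > 0 this is positive exactly on the open ball of radius 1/(2 sqrt s)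
  about \<open>a\<close>. With s = 1 the radius is 1/2, and with s = 1/\<epsilon>^2 it is
  \<epsilon>/2, the ball inscribed in a cube of side \<epsilon>.\<close>

definition bump :: "real \<Rightarrow> real \<Rightarrow> 'a::euclidean_space \<Rightarrow> 'a \<Rightarrow> real" where
  "bump C s a z = C * bump_fun 0 (1 / 4 - s * ((z - a) \<bullet> (z - a)))"

lemma bump_fun_0_pos_iff: "bump_fun 0 t > 0 \<longleftrightarrow> t > 0" and bump_fun_0_nonneg: "bump_fun 0 t \<ge> 0"
  by (auto simp: bump_fun_def)

lemma Ck_bump: "Ck k (bump C s a)"
proof -
  have "Ck k (\<lambda>z. 1 / 4 + (- s) * ((z - a) \<bullet> (z - a)))"
    by (intro Ck_add Ck_mult Ck_const Ck_inner_self)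
  then have "Ck k (\<lambda>z. 1 / 4 - s * ((z - a) \<bullet> (z - a)))" by simp
  from Ck_mult[OF Ck_const Ck_compose_real[where h = bump_fun, OF bump_fun_deriv this]]
  show ?thesis unfolding bump_def[abs_def] .
qed

lemma has_derivative_bump_fun_quadratic:
  "((\<lambda>z. bump_fun j (1 / 4 - s * ((z - a) \<bullet> (z - a)))) has_derivative
      (\<lambda>v. bump_fun (Suc j) (1 / 4 - s * ((z - a) \<bullet> (z - a))) * (- 2 * s * ((z - a) \<bullet> v)))) (at z)"
proof -
  have "((\<lambda>z. 1 / 4 - s * ((z - a) \<bullet> (z - a))) has_derivative (\<lambda>v. - 2 * s * ((z - a) \<bullet> v))) (at z)"
    by (rule derivative_eq_intros refl)+ (simp add: inner_commute algebra_simps)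
  from has_derivative_compose[OF this bump_fun_deriv[of j, unfolded has_field_derivative_def]]
  show ?thesis by simp
qed

lemma dird_bump:
  "dird v (bump C s a) = (\<lambda>z. C * (bump_fun 1 (1 / 4 - s * ((z - a) \<bullet> (z - a))) * (- 2 * s * ((z - a) \<bullet> v))))"
proof
  fix z
  have "(bump C s a has_derivative
      (\<lambda>v. C * (bump_fun 1 (1 / 4 - s * ((z - a) \<bullet> (z - a))) * (- 2 * s * ((z - a) \<bullet> v))))) (at z)"
    unfolding bump_def[abs_def] One_nat_def
    by (intro has_derivative_mult_right has_derivative_bump_fun_quadratic)
  then show "dird v (bump C s a) z = C * (bump_fun 1 (1 / 4 - s * ((z - a) \<bullet> (z - a))) * (- 2 * s * ((z - a) \<bullet> v)))"
    by (rule dird_eqI)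
qed

text \<open>The explicit formula for the second derivative is symmetric in \<open>u\<close> and
  \<open>v\<close>. This covers the mixed derivatives of a mollification, since they fall on the
  mollifier.\<close>

lemma dird_bump_commute: "dird u (dird v (bump C s a)) z = dird v (dird u (bump C s a)) z"
proof -
  let ?q = "1 / 4 - s * ((z - a) \<bullet> (z - a))"
  have "dird u (dird v (bump C s a)) z = C * (bump_fun 1 ?q * (- 2 * s * (u \<bullet> v))
      + bump_fun (Suc 1) ?q * (- 2 * s * ((z - a) \<bullet> u)) * (- 2 * s * ((z - a) \<bullet> v)))" for u v
    unfolding dird_bump One_nat_def
    by (rule dird_eqI, intro has_derivative_mult_right has_derivative_mult has_derivative_bump_fun_quadratic)
      (auto intro!: derivative_eq_intros)
  then show ?thesis by (simp add: inner_commute)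
qed

section \<open>Changes of variables and integration by parts\<close>

lemma integral_lborel_reflect_scale:
  fixes f :: "'a::euclidean_space \<Rightarrow> real"
  assumes [measurable]: "f \<in> borel_measurable borel" and "\<epsilon> > 0"
  shows "(LINT y|lborel. f ((x - y) /\<^sub>R \<epsilon>)) = \<epsilon> ^ DIM('a) * (LINT y|lborel. f y)"
proof -
  have "(LINT y|lborel. f ((x - y) /\<^sub>R \<epsilon>))
      = (LINT y|density (distr lborel borel (\<lambda>u. x + (-\<epsilon>) *\<^sub>R u)) (\<lambda>_. ennreal (\<bar>-\<epsilon>\<bar> ^ DIM('a))). f ((x - y) /\<^sub>R \<epsilon>))"
    using lborel_affine[of "-\<epsilon>" x] \<open>\<epsilon> > 0\<close> by (simp add: ennreal_power)
  also have "\<dots> = \<epsilon> ^ DIM('a) * (LINT y|lborel. f y)"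
    using \<open>\<epsilon> > 0\<close> by (simp add: integral_density integral_distr)
  finally show ?thesis .
qed

lemma integral_lborel_translate:
  fixes f :: "'a::euclidean_space \<Rightarrow> real"
  assumes [measurable]: "f \<in> borel_measurable borel"
  shows "(LINT x|lborel. f (x + v)) = (LINT x|lborel. f x)"
proof -
  have "(LINT x|lborel. f x) = (LINT x|distr lborel borel ((+) v). f x)"
    by (simp add: lborel_distr_plus)
  also have "\<dots> = (LINT x|lborel. f (x + v))"
    by (simp add: integral_distr add.commute)
  finally show ?thesis by simp
qed

lemma integral_lebesgue_lborel:
  fixes f :: "'a::euclidean_space \<Rightarrow> 'b::euclidean_space"
  assumes "continuous_on UNIV f"
  shows "(LINT x|lebesgue. f x) = (LINT x|lborel. f x)"
  by (intro integral_completion) (simp add: borel_measurable_continuous_onI assms)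

text \<open>By translation invariance every difference quotient of \<open>u\<close> has integral
  zero. The quotients converge to the derivative and, by the mean value theorem, are dominated by a
  constant on one fixed ball.\<close>

lemma integral_dird_eq_0:
  fixes u :: "'a::euclidean_space \<Rightarrow> real"
  assumes d: "\<And>x. (u has_derivative (\<lambda>v. u' v x)) (at x)"
    and c: "continuous_on UNIV (u' v)"
    and K: "compact K" "\<And>x. x \<notin> K \<Longrightarrow> u x = 0"
  shows "(LINT x|lebesgue. u' v x) = 0"
proof -
  have cu: "continuous_on UNIV u"
    using has_derivative_continuous[OF d] by (intro continuous_at_imp_continuous_on) blast
  have [measurable]: "u \<in> borel_measurable borel" "u' v \<in> borel_measurable borel"
    using cu c by (auto intro: borel_measurable_continuous_onI)
  have u'0: "u' v x = 0" if "x \<notin> K" for x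
    using dird_eq_0[of "- K" x u v] dird_eqI[OF d, of v x] K that by (auto simp: open_Compl compact_imp_closed)
  obtain M where M: "M \<ge> 0" "\<And>x. norm (u' v x) \<le> M"
    using continuous_compact_support_bounded[OF c K(1) u'0] by blast
  obtain B where B: "\<And>x. x \<in> K \<Longrightarrow> norm x \<le> B"
    using K(1) compact_imp_bounded bounded_iff by metis
  \<comment> \<open>The steps \<open>s n\<close> are at most 1, so outside this ball both
    \<open>x\<close> and \<open>x + s n *\<^sub>R v\<close> lie off \<open>K\<close>.\<close>
  let ?K = "cball 0 (B + norm v) :: 'a set"
  define s where "s n = inverse (real (Suc n))" for n
  have s: "s n > 0" "s n \<le> 1" for n by (auto simp: s_def field_simps)
  define Q where "Q n x = (u (x + s n *\<^sub>R v) - u x) / s n" for n x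
  have dl: "((\<lambda>t. u (x + t *\<^sub>R v)) has_real_derivative u' v (x + t *\<^sub>R v)) (at t)" for x t
  proof -
    have lin: "linear (\<lambda>v. u' v y)" for y using d has_derivative_linear by blast
    have "((\<lambda>t. u (x + t *\<^sub>R v)) has_derivative (\<lambda>h. u' (h *\<^sub>R v) (x + t *\<^sub>R v))) (at t)"
      by (rule has_derivative_compose[of "\<lambda>t. x + t *\<^sub>R v" "\<lambda>h. h *\<^sub>R v" t UNIV u "\<lambda>w. u' w (x + t *\<^sub>R v)"])
        (auto intro!: derivative_eq_intros d)
    then show ?thesis by (simp add: has_field_derivative_def linear_scale[OF lin] mult.commute[of _ "u' v _"])
  qed
  have Qlim: "(\<lambda>n. Q n x) \<longlonglongrightarrow> u' v x" for x
  proof -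
    have "((\<lambda>h. (u (x + (0 + h) *\<^sub>R v) - u (x + 0 *\<^sub>R v)) / h) \<longlongrightarrow> u' v (x + 0 *\<^sub>R v)) (at 0)"
      using dl[of x 0] unfolding DERIV_def .
    moreover have "filterlim s (at 0) sequentially"
      unfolding filterlim_at s_def using LIMSEQ_inverse_real_of_nat by auto
    ultimately show ?thesis unfolding Q_def using filterlim_compose by fastforce
  qed
  have Qbd: "norm (Q n x) \<le> M * indicator ?K x" for n x
  proof (cases "x \<in> ?K")
    case True
    obtain \<xi> where "u (x + s n *\<^sub>R v) - u (x + 0 *\<^sub>R v) = (s n - 0) * u' v (x + \<xi> *\<^sub>R v)"
      using MVT2[OF s(1)[of n], of "\<lambda>t. u (x + t *\<^sub>R v)" "\<lambda>t. u' v (x + t *\<^sub>R v)"] dl by blast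
    then have "Q n x = u' v (x + \<xi> *\<^sub>R v)" using s(1)[of n] by (simp add: Q_def)
    then show ?thesis using True M(2) by simp
  next
    case False
    then have *: "norm x > B + norm v" by simp
    have "norm (s n *\<^sub>R v) \<le> norm v" using s[of n] by (simp add: mult_left_le_one_le)
    then have "norm (x + s n *\<^sub>R v) > B" using * norm_diff_ineq[of x "s n *\<^sub>R v"] by linarith
    moreover have "norm x > B" using * norm_ge_zero[of v] by linarith
    ultimately have "u (x + s n *\<^sub>R v) = 0" "u x = 0" using B K(2) by (meson not_le)+
    then show ?thesis using False by (simp add: Q_def)
  qed
  have "(\<lambda>n. LINT x|lborel. Q n x) \<longlonglongrightarrow> (LINT x|lborel. u' v x)"
  proof (rule integral_dominated_convergence[where w = "\<lambda>x. M * indicator ?K x"])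
    show "integrable lborel (\<lambda>x. M * indicator ?K x)"
      by (intro integrable_mult_right integrable_real_indicator) (use emeasure_bounded_finite[of ?K] in auto)
    show "Q n \<in> borel_measurable lborel" for n unfolding Q_def[abs_def] by measurable
  qed (use Qlim Qbd in auto)
  moreover have "(LINT x|lborel. Q n x) = 0" for n
  proof -
    have iu: "integrable lborel u" using continuous_compact_support_integrable[OF cu K] by blast
    have iv: "integrable lborel (\<lambda>x. u (x + s n *\<^sub>R v))"
      by (rule continuous_compact_support_integrable[of _ ?K])
        (use Qbd[of n] iu B K(2) in \<open>auto intro!: continuous_on_compose2[OF cu] continuous_intros\<close>,
         smt (verit) K(2) B s mult_left_le_one_le norm_ge_zero norm_scaleR norm_diff_ineq)
    show ?thesis unfolding Q_def using iu iv by (simp add: integral_lborel_translate)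
  qed
  ultimately have "(LINT x|lborel. u' v x) = 0" using LIMSEQ_unique tendsto_const by (simp add: LIMSEQ_const_iff)
  then show ?thesis using integral_lebesgue_lborel[OF c] by simp
qed

text \<open>The product of \<open>\<phi>\<close> and \<open>h\<close> inherits compact support from
  \<open>\<phi>\<close>, so its directional derivative integrates to zero; the product rule does the
  rest.\<close>

lemma integral_by_parts_dird:
  fixes \<phi> h :: "'a::euclidean_space \<Rightarrow> real"
  assumes \<phi>: "test_function \<Omega> \<phi>"
    and d: "\<And>x. (h has_derivative (\<lambda>v. h' v x)) (at x)"
    and c: "continuous_on UNIV (h' v)"
  shows "(LINT x|lebesgue. \<phi> x * h' v x) = - (LINT x|lebesgue. dird v \<phi> x * h x)"
proof -
  let ?K = "closure {x. \<phi> x \<noteq> 0}"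
  have K: "compact ?K" using \<phi> by (simp add: test_function_def)
  have ch: "continuous_on UNIV h"
    using has_derivative_continuous[OF d] by (intro continuous_at_imp_continuous_on) blast
  note c\<phi> = test_function_continuous[OF \<phi>] and cd = test_function_continuous[OF test_function_dird[OF \<phi>], of v]
  have 0: "dird v \<phi> x = 0" if "x \<notin> ?K" for x
    by (rule dird_eq_0[where S = "- ?K"]) (use that outside_support in auto)
  have i1: "integrable lebesgue (\<lambda>x. \<phi> x * h' v x)"
    by (rule continuous_compact_support_integrable[OF _ K]) (use c\<phi> c outside_support in \<open>auto intro: continuous_intros\<close>)
  have i2: "integrable lebesgue (\<lambda>x. dird v \<phi> x * h x)"
    by (rule continuous_compact_support_integrable[OF _ K]) (use cd ch 0 in \<open>auto intro: continuous_intros\<close>)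
  have "(LINT x|lebesgue. \<phi> x * h' v x + dird v \<phi> x * h x) = 0"
    by (rule integral_dird_eq_0[where u = "\<lambda>x. \<phi> x * h x" and u' = "\<lambda>v x. \<phi> x * h' v x + dird v \<phi> x * h x" and K = ?K])
      (use K outside_support c\<phi> cd c ch in \<open>auto intro!: derivative_intros continuous_intros test_function_has_derivative[OF \<phi>] d\<close>)
  then show ?thesis using i1 i2 by simp
qed

section \<open>Mollification\<close>

definition moll_const :: "'a::euclidean_space itself \<Rightarrow> real" where
  "moll_const _ = (LINT z|lborel. bump 1 1 (- ((1/2) *\<^sub>R (One::'a))) z)"

text \<open>
  A smooth mollifier at scale \<open>\<epsilon>\<close> supported in the cube \<open>[-\<epsilon>, 0]\<^sup>n\<close>, so that \<open>moll \<epsilon> (x - y)\<close>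
  lives on the corner cube \<open>x + [0, \<epsilon>]\<^sup>n\<close> for which the library has Lebesgue's differentiation theorem.
\<close>

definition moll :: "real \<Rightarrow> 'a::euclidean_space \<Rightarrow> real" where
  "moll \<epsilon> = bump (inverse (moll_const TYPE('a) * \<epsilon> ^ DIM('a))) (inverse \<epsilon> ^ 2) (- ((\<epsilon>/2) *\<^sub>R One))"

text \<open>Outside the cube some coordinate is at least 1/2 away from that of the centre, so the
  argument 1/4 - |z - a|^2 of the flat function is not positive.\<close>

lemma bump_unit_outside:
  assumes "z \<notin> cbox (- One) (0::'a::euclidean_space)"
  shows "bump C 1 (- ((1/2) *\<^sub>R One)) z = 0"
proof -
  let ?w = "z - (- ((1/2) *\<^sub>R One))"
  obtain b where b: "b \<in> Basis" "z \<bullet> b < - 1 \<or> z \<bullet> b > 0"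
    using assms by (force simp: mem_box)
  have "?w \<bullet> b = z \<bullet> b + 1 / 2" using b(1) by (simp add: inner_simps)
  then have "1 / 2 \<le> \<bar>?w \<bullet> b\<bar>" using b(2) by linarith
  also have "\<dots> \<le> norm ?w" using b(1) by (rule Basis_le_norm)
  finally have "(1 / 2)\<^sup>2 \<le> (norm ?w)\<^sup>2" by (intro power_mono) auto
  then show ?thesis unfolding bump_def bump_fun_def power2_norm_eq_inner by (simp add: power2_eq_square)
qed

lemma Ck_integrable_compact:
  fixes \<phi> :: "'a::euclidean_space \<Rightarrow> real"
  assumes "Ck k \<phi>" "compact K" "\<And>z. z \<notin> K \<Longrightarrow> \<phi> z = 0"
  shows "integrable lborel \<phi>" "integrable lebesgue \<phi>"
  using continuous_compact_support_integrable[OF Ck_continuous[OF assms(1)] assms(2,3)] by auto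

text \<open>A vanishing integral would make the open set where the bump is positive negligible,
  although it contains the centre.\<close>

lemma moll_const_pos: "moll_const TYPE('a::euclidean_space) > 0"
proof -
  let ?b = "bump 1 1 (- ((1/2) *\<^sub>R (One::'a)))"
  have I: "integrable lborel ?b"
    by (rule Ck_integrable_compact[OF Ck_bump[where k=0] compact_cbox[of "- One" 0]]) (rule bump_unit_outside)
  have nn: "?b z \<ge> 0" for z by (simp add: bump_def bump_fun_0_nonneg)
  have "moll_const TYPE('a) \<noteq> 0"
  proof
    assume "moll_const TYPE('a) = 0"
    then have "AE z in lborel. ?b z = 0"
      using integral_nonneg_eq_0_iff_AE[OF I] nn by (simp add: moll_const_def)
    then have "AE z in lborel. z \<notin> {z. ?b z > 0}" by (auto elim!: eventually_mono)
    moreover have op: "open {z. ?b z > 0}"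
      using Ck_continuous[OF Ck_bump] by (intro open_Collect_less) auto
    ultimately have "{z. ?b z > 0} \<in> null_sets lborel"
      using AE_iff_null_sets[of "{z. ?b z > 0}" lborel] by (simp add: borel_open)
    then have "negligible {z. ?b z > 0}"
      by (simp add: negligible_iff_null_sets null_sets_completionI)
    then have "{z. ?b z > 0} = {}" using op open_not_negligible by blast
    moreover have "- ((1/2) *\<^sub>R One) \<in> {z. ?b z > 0}"
      by (simp add: bump_def bump_fun_0_pos_iff)
    ultimately show False by blast
  qed
  moreover have "moll_const TYPE('a) \<ge> 0" unfolding moll_const_def by (rule Bochner_Integration.integral_nonneg) (rule nn)
  ultimately show ?thesis by simp
qed

lemma moll_nonneg: "\<epsilon> > 0 \<Longrightarrow> moll \<epsilon> (z::'a::euclidean_space) \<ge> 0"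
  using moll_const_pos[where 'a = 'a] by (simp add: moll_def bump_def bump_fun_0_nonneg)

lemma moll_scale:
  fixes z :: "'a::euclidean_space"
  assumes "\<epsilon> > 0"
  shows "moll \<epsilon> z = inverse (moll_const TYPE('a) * \<epsilon> ^ DIM('a)) * bump 1 1 (- ((1/2) *\<^sub>R One)) (z /\<^sub>R \<epsilon>)"
proof -
  have *: "z - (- ((\<epsilon>/2) *\<^sub>R One)) = \<epsilon> *\<^sub>R (z /\<^sub>R \<epsilon> - (- ((1/2) *\<^sub>R One)))"
    using assms by (simp add: scaleR_add_right)
  have sc: "(inverse \<epsilon>)\<^sup>2 * ((\<epsilon> *\<^sub>R w) \<bullet> (\<epsilon> *\<^sub>R w)) = w \<bullet> w" for w :: 'a
    using assms by (simp add: power2_eq_square field_simps)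
  show ?thesis unfolding moll_def bump_def * sc by simp
qed

lemma moll_outside:
  fixes z :: "'a::euclidean_space"
  assumes "\<epsilon> > 0" "z \<notin> cbox (- \<epsilon> *\<^sub>R One) 0"
  shows "moll \<epsilon> z = 0"
proof -
  have "z /\<^sub>R \<epsilon> \<notin> cbox (- One) 0"
    using assms by (auto simp: mem_box field_simps)
  then show ?thesis using assms by (simp add: moll_scale bump_unit_outside)
qed

lemma moll_test: "\<epsilon> > 0 \<Longrightarrow> test_function UNIV (moll \<epsilon> :: 'a::euclidean_space \<Rightarrow> real)"
  by (rule test_functionI[where K = "cbox (- \<epsilon> *\<^sub>R One) 0"])
    (auto simp: moll_outside, auto simp: moll_def Ck_bump)

lemma dird_moll_commute: "dird u (dird v (moll \<epsilon>)) = dird v (dird u (moll \<epsilon>))"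
  unfolding moll_def by (intro ext dird_bump_commute)

lemma continuous_on_moll_reflect:
  "\<epsilon> > 0 \<Longrightarrow> continuous_on UNIV (\<lambda>y. moll \<epsilon> (x - y :: 'a::euclidean_space))"
  by (rule continuous_on_compose2[OF test_function_continuous[OF moll_test]]) (auto intro!: continuous_intros)

lemma moll_integral:
  fixes x :: "'a::euclidean_space"
  assumes "\<epsilon> > 0"
  shows "(LINT y|lebesgue. moll \<epsilon> (x - y)) = 1"
proof -
  let ?b = "bump 1 1 (- ((1/2) *\<^sub>R (One::'a)))"
  have "(LINT y|lebesgue. moll \<epsilon> (x - y)) = (LINT y|lborel. moll \<epsilon> (x - y))"
    by (rule integral_lebesgue_lborel) (rule continuous_on_moll_reflect[OF assms])
  also have "\<dots> = inverse (moll_const TYPE('a) * \<epsilon> ^ DIM('a)) * (LINT y|lborel. ?b ((x - y) /\<^sub>R \<epsilon>))"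
    using assms by (simp add: moll_scale)
  also have "(LINT y|lborel. ?b ((x - y) /\<^sub>R \<epsilon>)) = \<epsilon> ^ DIM('a) * moll_const TYPE('a)"
    unfolding moll_const_def
    by (rule integral_lborel_reflect_scale)
      (use assms borel_measurable_continuous_onI[OF Ck_continuous[OF Ck_bump]] in auto)
  finally show ?thesis using assms moll_const_pos[where 'a = 'a] by (simp add: field_simps)
qed

text \<open>The power of \<epsilon> matches the volume of the corner cube, so a convolution is
  controlled by an average over that cube, with a constant independent of the scale.\<close>

lemma moll_bound:
  obtains M where "M \<ge> 0" "\<And>\<epsilon> z. \<epsilon> > 0 \<Longrightarrow> moll \<epsilon> (z::'a::euclidean_space) \<le> M / \<epsilon> ^ DIM('a)"
proof -
  let ?b = "bump 1 1 (- ((1/2) *\<^sub>R (One::'a)))"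
  obtain B where B: "B \<ge> 0" "\<And>z. norm (?b z) \<le> B"
    using continuous_compact_support_bounded[OF Ck_continuous[OF Ck_bump] compact_cbox bump_unit_outside] by blast
  have "moll \<epsilon> z \<le> B / moll_const TYPE('a) / \<epsilon> ^ DIM('a)" if "\<epsilon> > 0" for \<epsilon> and z :: 'a
    using B(2)[of "z /\<^sub>R \<epsilon>"] that moll_const_pos[where 'a = 'a]
    by (simp add: moll_scale field_simps)
  then show ?thesis using that[of "B / moll_const TYPE('a)"] B(1) moll_const_pos[where 'a = 'a] by simp
qed

section \<open>Mollification as averaging over corner cubes, and its limits\<close>

lemma moll_reflect_outside:
  assumes "\<epsilon> > 0" "y \<notin> cbox x (x + \<epsilon> *\<^sub>R (One::'a::euclidean_space))"
  shows "moll \<epsilon> (x - y) = 0"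
proof (rule moll_outside[OF assms(1)])
  show "x - y \<notin> cbox (- \<epsilon> *\<^sub>R One) 0"
    using assms(2) by (auto simp: mem_box inner_simps algebra_simps)
qed

lemma moll_reflect_integrable:
  assumes "\<epsilon> > 0"
  shows "integrable lebesgue (\<lambda>y. moll \<epsilon> (x - y :: 'a::euclidean_space))"
  by (rule continuous_compact_support_integrable[OF continuous_on_moll_reflect[OF assms] compact_cbox])
    (rule moll_reflect_outside[OF assms])

text \<open>Unit mass allows \<open>w\<close> to be moved under the integral. It stays arbitrary
  because it serves as the value \<open>f x\<close>, as 0, and as a point of a countable dense
  set.\<close>

lemma conv_moll_minus_const:
  fixes f :: "'a::euclidean_space \<Rightarrow> 'b::euclidean_space"
  assumes "\<epsilon> > 0" "integrable lebesgue f"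
  shows "norm (conv (moll \<epsilon>) f x - w) \<le> (LINT y|lebesgue. moll \<epsilon> (x - y) * norm (f y - w))"
    and "integrable lebesgue (\<lambda>y. moll \<epsilon> (x - y) * norm (f y - w))"
proof -
  note I = conv_integrable[OF moll_test[OF assms(1)] assms(2), of x]
    integrable_scaleR_left[OF moll_reflect_integrable[OF assms(1), of x], of w]
  have 1: "integrable lebesgue (\<lambda>y. moll \<epsilon> (x - y) *\<^sub>R (f y - w))"
    unfolding scaleR_diff_right by (intro Bochner_Integration.integrable_diff I)
  have n: "norm (moll \<epsilon> (x - y) *\<^sub>R (f y - w)) = moll \<epsilon> (x - y) * norm (f y - w)" for y
    using moll_nonneg[OF assms(1), of "x - y"] by simp
  show "integrable lebesgue (\<lambda>y. moll \<epsilon> (x - y) * norm (f y - w))"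
    using integrable_norm[OF 1] unfolding n .
  have "(LINT y|lebesgue. moll \<epsilon> (x - y) *\<^sub>R w) = w"
    using moll_integral[OF assms(1), of x] integral_scaleR_left[OF moll_reflect_integrable[OF assms(1), of x], of w] by simp
  then have "conv (moll \<epsilon>) f x - w = (LINT y|lebesgue. moll \<epsilon> (x - y) *\<^sub>R (f y - w))"
    unfolding conv_def scaleR_diff_right Bochner_Integration.integral_diff[OF I] by simp
  then show "norm (conv (moll \<epsilon>) f x - w) \<le> (LINT y|lebesgue. moll \<epsilon> (x - y) * norm (f y - w))"
    using integral_norm_bound[of lebesgue "\<lambda>y. moll \<epsilon> (x - y) *\<^sub>R (f y - w)"] unfolding n by simp
qed

lemma conv_moll_close:
  fixes f :: "'a::euclidean_space \<Rightarrow> 'b::euclidean_space"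
  assumes "\<epsilon> > 0" "integrable lebesgue f"
    "AE y in lebesgue. y \<in> cbox x (x + \<epsilon> *\<^sub>R One) \<longrightarrow> norm (f y - w) \<le> \<delta>"
  shows "norm (conv (moll \<epsilon>) f x - w) \<le> \<delta>"
proof -
  have "norm (conv (moll \<epsilon>) f x - w) \<le> (LINT y|lebesgue. moll \<epsilon> (x - y) * norm (f y - w))"
    by (rule conv_moll_minus_const[OF assms(1,2)])
  also have "\<dots> \<le> (LINT y|lebesgue. moll \<epsilon> (x - y) * \<delta>)"
  proof (rule integral_mono_AE)
    show "AE y in lebesgue. moll \<epsilon> (x - y) * norm (f y - w) \<le> moll \<epsilon> (x - y) * \<delta>"
      using assms(3)
    proof eventually_elim
      case (elim y)
      then show ?case
        using moll_nonneg[OF assms(1), of "x - y"] moll_reflect_outside[OF assms(1), of y x]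
        by (cases "y \<in> cbox x (x + \<epsilon> *\<^sub>R One)") (auto intro: mult_left_mono)
    qed
    show "integrable lebesgue (\<lambda>y. moll \<epsilon> (x - y) * \<delta>)"
      using moll_reflect_integrable[OF assms(1)] by (rule integrable_mult_left)
  qed (rule conv_moll_minus_const[OF assms(1,2)])
  also have "\<dots> = \<delta>" using moll_integral[OF assms(1), of x] by simp
  finally show ?thesis .
qed

lemma conv_moll_bound:
  fixes f :: "'a::euclidean_space \<Rightarrow> 'b::euclidean_space"
  assumes "\<epsilon> > 0" "integrable lebesgue f" "AE y in lebesgue. norm (f y) \<le> c"
  shows "norm (conv (moll \<epsilon>) f x) \<le> c"
proof -
  have "AE y in lebesgue. y \<in> cbox x (x + \<epsilon> *\<^sub>R One) \<longrightarrow> norm (f y - 0) \<le> c"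
    using assms(3) by eventually_elim simp
  from conv_moll_close[OF assms(1,2) this] show ?thesis by simp
qed

text \<open>A crude estimate through the l1 norm; it is the source of the dimension factor in the
  later radius conditions.\<close>

lemma norm_cbox_corner:
  assumes "y \<in> cbox x (x + \<epsilon> *\<^sub>R (One::'a::euclidean_space))" "\<epsilon> > 0"
  shows "norm (y - x) \<le> \<epsilon> * DIM('a)"
proof -
  have "norm (y - x) \<le> (\<Sum>b\<in>Basis. \<bar>(y - x) \<bullet> b\<bar>)" by (rule norm_le_l1)
  also have "\<dots> \<le> (\<Sum>b\<in>(Basis::'a set). \<epsilon>)"
    using assms by (intro sum_mono) (auto simp: mem_box inner_simps algebra_simps abs_le_iff)
  finally show ?thesis by (simp add: mult.commute)
qed

lemma conv_moll_tendsto_continuous: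
  fixes f :: "'a::euclidean_space \<Rightarrow> 'b::euclidean_space"
  assumes "integrable lebesgue f" "isCont f x"
  shows "((\<lambda>\<epsilon>. conv (moll \<epsilon>) f x) \<longlongrightarrow> f x) (at_right 0)"
proof (rule tendstoI)
  fix e :: real assume "e > 0"
  then obtain d where d: "d > 0" "\<And>y. norm (y - x) < d \<Longrightarrow> norm (f y - f x) < e / 2"
    using assms(2) unfolding continuous_at_eps_delta dist_norm by (metis half_gt_zero)
  have "dist (conv (moll \<epsilon>) f x) (f x) < e" if "\<epsilon> > 0" "\<epsilon> < d / DIM('a)" for \<epsilon>
  proof -
    have "norm (f y - f x) \<le> e / 2" if "y \<in> cbox x (x + \<epsilon> *\<^sub>R One)" for y
      using norm_cbox_corner[OF that \<open>\<epsilon> > 0\<close>] \<open>\<epsilon> < d / DIM('a)\<close> d(2)[of y] by (simp add: field_simps)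
    then have "norm (conv (moll \<epsilon>) f x - f x) \<le> e / 2"
      using that(1) assms(1) by (intro conv_moll_close) auto
    then show ?thesis using \<open>e > 0\<close> by (simp add: dist_norm)
  qed
  then show "eventually (\<lambda>\<epsilon>. dist (conv (moll \<epsilon>) f x) (f x) < e) (at_right 0)"
    unfolding eventually_at_right_field using d(1) by (intro exI[of _ "d / DIM('a)"]) auto
qed

text \<open>Lebesgue points: the differentiation theorem for |f - q| has an exceptional set
  depending on \<open>q\<close>, so \<open>q\<close> runs through a countable dense set and the
  exceptional sets are united. At a remaining point \<open>f x\<close> is approximated by some
  \<open>q\<close>.\<close>

lemma conv_moll_tendsto_AE:
  fixes f :: "'a::euclidean_space \<Rightarrow> 'b::euclidean_space"
  assumes f: "integrable lebesgue f"
  shows "AE x in lebesgue. ((\<lambda>\<epsilon>. conv (moll \<epsilon>) f x) \<longlongrightarrow> f x) (at_right 0)"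
proof -
  obtain D :: "'b set" where D: "countable D" "\<And>X. open X \<Longrightarrow> X \<noteq> {} \<Longrightarrow> \<exists>d\<in>D. d \<in> X"
    using countable_dense_setE by blast
  have ai: "(\<lambda>y. norm (f y - q)) absolutely_integrable_on cbox a b" for q a b
  proof -
    have "f absolutely_integrable_on cbox a b"
      using f by (auto simp: set_integrable_def intro: integrable_mult_indicator)
    then have "(\<lambda>y. f y - q) absolutely_integrable_on cbox a b"
      by (rule set_integral_diff) (auto simp: absolutely_integrable_on_const)
    then show ?thesis by (rule absolutely_integrable_norm[unfolded o_def])
  qed
  let ?avg = "\<lambda>q x h. integral (cbox x (x + h *\<^sub>R One)) (\<lambda>y. norm (f y - q)) / h ^ DIM('a)"
  have "\<exists>N. negligible N \<and> (\<forall>x e. x \<notin> N \<longrightarrow> e > 0 \<longrightarrow>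
       (\<exists>d>0. \<forall>h. 0 < h \<and> h < d \<longrightarrow> norm (?avg q x h - norm (f x - q)) < e))" for q
    using integrable_ccontinuous_explicit[of "\<lambda>y. norm (f y - q)"]
      set_lebesgue_integral_eq_integral(1)[OF ai] by (simp add: divide_inverse mult.commute) metis
  then obtain N where N: "\<And>q. negligible (N q)"
    "\<And>q x e. x \<notin> N q \<Longrightarrow> e > 0 \<Longrightarrow> \<exists>d>0. \<forall>h. 0 < h \<and> h < d \<longrightarrow> norm (?avg q x h - norm (f x - q)) < e"
    by metis
  obtain M where M: "M \<ge> 0" "\<And>\<epsilon> z. \<epsilon> > 0 \<Longrightarrow> moll \<epsilon> (z::'a) \<le> M / \<epsilon> ^ DIM('a)"
    using moll_bound[where 'a = 'a] by blast
  have main: "((\<lambda>\<epsilon>. conv (moll \<epsilon>) f x) \<longlongrightarrow> f x) (at_right 0)" if x: "x \<notin> (\<Union>q\<in>D. N q)" for x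
  proof (rule tendstoI)
    fix e :: real assume e: "e > 0"
    \<comment> \<open>The cube average costs at most \<open>M * e'\<close> and replacing
      \<open>q\<close> by \<open>f x\<close> costs \<open>e' / 2\<close>; together this is below
      \<open>2 * (M + 1) * e' = e\<close>.\<close>
    define e' where "e' = e / (2 * (M + 1))"
    have e': "e' > 0" using e M by (simp add: e'_def add_nonneg_pos)
    obtain q where q: "q \<in> D" "q \<in> ball (f x) (e' / 2)"
      using D(2)[of "ball (f x) (e' / 2)"] e' by auto
    then have qx: "norm (f x - q) < e' / 2" by (simp add: dist_norm)
    obtain d where d: "d > 0" "\<And>h. 0 < h \<Longrightarrow> h < d \<Longrightarrow> norm (?avg q x h - norm (f x - q)) < e' / 2"
      using N(2)[of x q "e' / 2"] x q(1) e' by auto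
    have "dist (conv (moll \<epsilon>) f x) (f x) < e" if \<epsilon>: "0 < \<epsilon>" "\<epsilon> < d" for \<epsilon>
    proof -
      let ?C = "cbox x (x + \<epsilon> *\<^sub>R One)"
      have "norm (conv (moll \<epsilon>) f x - q) \<le> (LINT y|lebesgue. moll \<epsilon> (x - y) * norm (f y - q))"
        by (rule conv_moll_minus_const[OF \<epsilon>(1) f])
      also have "\<dots> \<le> (LINT y|lebesgue. (M / \<epsilon> ^ DIM('a)) * (indicator ?C y * norm (f y - q)))"
      proof (rule integral_mono)
        show "integrable lebesgue (\<lambda>y. moll \<epsilon> (x - y) * norm (f y - q))"
          by (rule conv_moll_minus_const[OF \<epsilon>(1) f])
        show "integrable lebesgue (\<lambda>y. (M / \<epsilon> ^ DIM('a)) * (indicator ?C y * norm (f y - q)))"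
          using ai[where q = q and a = x and b = "x + \<epsilon> *\<^sub>R One"] unfolding set_integrable_def by (intro integrable_mult_right) simp
        show "moll \<epsilon> (x - y) * norm (f y - q) \<le> (M / \<epsilon> ^ DIM('a)) * (indicator ?C y * norm (f y - q))" for y
          using mult_right_mono[OF M(2)[OF \<epsilon>(1), of "x - y"], of "norm (f y - q)"] moll_reflect_outside[OF \<epsilon>(1), of y x]
          by (cases "y \<in> ?C") auto
      qed
      also have "\<dots> = M * ?avg q x \<epsilon>"
        using set_lebesgue_integral_eq_integral(2)[OF ai[where q = q and a = x and b = "x + \<epsilon> *\<^sub>R One"]]
        by (simp add: set_lebesgue_integral_def)
      also have "?avg q x \<epsilon> \<le> e'"
        using d(2)[OF \<epsilon>] qx unfolding real_norm_def by linarith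
      then have "M * ?avg q x \<epsilon> \<le> M * e'"
        using M(1) by (rule mult_left_mono)
      finally have "norm (conv (moll \<epsilon>) f x - f x) \<le> M * e' + e' / 2"
        using qx norm_triangle_ineq4[of "conv (moll \<epsilon>) f x - q" "f x - q"] by simp
      also have "\<dots> < (M + 1) * e' * 2" using e' mult_nonneg_nonneg[OF M(1), of e'] by (simp add: algebra_simps)
      also have "\<dots> = e" using M(1) by (simp add: e'_def field_simps)
      finally show ?thesis by (simp add: dist_norm)
    qed
    then show "eventually (\<lambda>\<epsilon>. dist (conv (moll \<epsilon>) f x) (f x) < e) (at_right 0)"
      unfolding eventually_at_right_field using d(1) by blast
  qed
  have "negligible (\<Union>q\<in>D. N q)"
    using D(1) N(1) by (intro negligible_countable_Union) auto
  then have "(\<Union>q\<in>D. N q) \<in> null_sets lebesgue" by (simp add: negligible_iff_null_sets)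
  then show ?thesis
    by (rule AE_I') (use main in blast)
qed

section \<open>Covectors and calibrations\<close>

lemma axis_rep: "(\<Sum>k\<in>UNIV. (x $ k) *\<^sub>R axis k 1) = (x :: real^'m::finite)"
  using basis_expansion[of x] by (simp add: scalar_mult_eq_scaleR)

lemma covector_linear: "covector \<omega> \<Longrightarrow> linear (\<lambda>x. \<omega> (v(i := x)))"
  by (simp add: covector_def)

text \<open>As a polynomial in the coordinates of its arguments, a covector gets its bounds, limits
  and derivatives from those of finite sums and products.\<close>

lemma covector_expand:
  fixes \<omega> :: "('n::finite \<Rightarrow> real^'m::finite) \<Rightarrow> real"
  assumes "covector \<omega>"
  shows "\<omega> v = (\<Sum>f\<in>UNIV. (\<Prod>i\<in>UNIV. v i $ f i) * \<omega> (\<lambda>i. axis (f i) 1))"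
proof -
  \<comment> \<open>\<open>S\<close> is the set of slots already expanded in the basis; each
    induction step expands one more slot by linearity.\<close>
  have "\<omega> v = (\<Sum>f\<in>S \<rightarrow>\<^sub>E UNIV. (\<Prod>i\<in>S. v i $ f i) * \<omega> (\<lambda>i. if i \<in> S then axis (f i) 1 else v i))"
    if "finite S" for S :: "'n set"
    using that
  proof (induction S)
    case empty
    show ?case by simp
  next
    case (insert a S)
    have lin1: "(\<Sum>k\<in>UNIV. (v a $ k) * \<omega> (u(a := axis k 1))) = \<omega> u" if "u a = v a" for u
    proof -
      note lin = covector_linear[OF assms, of u a]
      have "\<omega> (u(a := v a)) = \<omega> (u(a := (\<Sum>k\<in>UNIV. (v a $ k) *\<^sub>R axis k 1)))"
        by (simp only: axis_rep)
      also have "\<dots> = (\<Sum>k\<in>UNIV. (v a $ k) * \<omega> (u(a := axis k 1)))"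
        by (simp add: linear_sum[OF lin] linear_scale[OF lin])
      finally show ?thesis using that by (metis fun_upd_triv)
    qed
    let ?g = "\<lambda>f i. if i \<in> S then axis (f i) 1 else v i"
    have "(\<Sum>f\<in>insert a S \<rightarrow>\<^sub>E UNIV. (\<Prod>i\<in>insert a S. v i $ f i) * \<omega> (\<lambda>i. if i \<in> insert a S then axis (f i) 1 else v i))
        = (\<Sum>(k, f)\<in>UNIV \<times> (S \<rightarrow>\<^sub>E UNIV). (\<Prod>i\<in>insert a S. v i $ (f(a := k)) i) *
            \<omega> (\<lambda>i. if i \<in> insert a S then axis ((f(a := k)) i) 1 else v i))"
      unfolding PiE_insert_eq
      by (subst sum.reindex) (use inj_combinator[OF insert.hyps(2), of "\<lambda>_. UNIV"] in \<open>auto simp: case_prod_unfold\<close>)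
    also have "\<dots> = (\<Sum>(k, f)\<in>UNIV \<times> (S \<rightarrow>\<^sub>E UNIV). (\<Prod>i\<in>S. v i $ f i) * (v a $ k * \<omega> ((?g f)(a := axis k 1))))"
    proof (intro sum.cong refl, clarify)
      fix k f
      have "(\<Prod>i\<in>S. v i $ (f(a := k)) i) = (\<Prod>i\<in>S. v i $ f i)"
        using insert.hyps by (intro prod.cong) auto
      moreover have "(\<lambda>i. if i \<in> insert a S then axis ((f(a := k)) i) 1 else v i) = (?g f)(a := axis k 1)"
        by auto
      ultimately show "(\<Prod>i\<in>insert a S. v i $ (f(a := k)) i) * \<omega> (\<lambda>i. if i \<in> insert a S then axis ((f(a := k)) i) 1 else v i)
          = (\<Prod>i\<in>S. v i $ f i) * (v a $ k * \<omega> ((?g f)(a := axis k 1)))"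
        using insert.hyps by simp
    qed
    also have "\<dots> = (\<Sum>f\<in>S \<rightarrow>\<^sub>E UNIV. \<Sum>k\<in>UNIV. (\<Prod>i\<in>S. v i $ f i) * (v a $ k * \<omega> ((?g f)(a := axis k 1))))"
      unfolding sum.cartesian_product[symmetric] by (rule sum.swap)
    also have "\<dots> = (\<Sum>f\<in>S \<rightarrow>\<^sub>E UNIV. (\<Prod>i\<in>S. v i $ f i) * \<omega> (?g f))"
      unfolding sum_distrib_left[symmetric] by (intro sum.cong refl, subst lin1) (use insert.hyps in auto)
    finally show ?case using insert.IH by simp
  qed
  from this[of UNIV] show ?thesis by simp
qed

text \<open>Supplies the boundedness under which the \<open>Sup\<close> in \<open>comass\<close>
  really bounds its members.\<close>

lemma covector_bound:
  fixes \<omega> :: "('n::finite \<Rightarrow> real^'m::finite) \<Rightarrow> real"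
  assumes "covector \<omega>"
  obtains C where "C \<ge> 0" "\<And>v. \<bar>\<omega> v\<bar> \<le> C * (\<Prod>i\<in>UNIV. norm (v i))"
proof
  let ?C = "\<Sum>f\<in>UNIV. \<bar>\<omega> (\<lambda>i. axis (f i) 1)\<bar>"
  show "?C \<ge> 0" by (intro sum_nonneg) auto
  show "\<bar>\<omega> v\<bar> \<le> ?C * (\<Prod>i\<in>UNIV. norm (v i))" for v
  proof -
    have "\<bar>\<omega> v\<bar> \<le> (\<Sum>f\<in>UNIV. \<bar>(\<Prod>i\<in>UNIV. v i $ f i) * \<omega> (\<lambda>i. axis (f i) 1)\<bar>)"
      by (subst covector_expand[OF assms]) (rule sum_abs)
    also have "\<dots> \<le> (\<Sum>f\<in>UNIV. (\<Prod>i\<in>UNIV. norm (v i)) * \<bar>\<omega> (\<lambda>i. axis (f i) 1)\<bar>)"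
      by (intro sum_mono) (auto simp: abs_mult abs_prod component_le_norm_cart intro!: mult_right_mono prod_mono)
    finally show ?thesis by (simp add: sum_distrib_left mult.commute)
  qed
qed

lemma covector_has_derivative:
  fixes \<omega> :: "('n::finite \<Rightarrow> real^'m::finite) \<Rightarrow> real" and g :: "'n \<Rightarrow> 'a::real_normed_vector \<Rightarrow> real^'m"
  assumes \<omega>: "covector \<omega>" and g: "\<And>i. (g i has_derivative g' i) (at x)"
  shows "((\<lambda>x. \<omega> (\<lambda>i. g i x)) has_derivative (\<lambda>h. \<Sum>j\<in>UNIV. \<omega> ((\<lambda>i. g i x)(j := g' j h)))) (at x)"
proof -
  let ?c = "\<lambda>f. \<omega> (\<lambda>i. axis (f i) 1)"
  have nth: "((\<lambda>x. g i x $ k) has_derivative (\<lambda>h. g' i h $ k)) (at x)" for i k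
    using g bounded_linear.has_derivative[OF bounded_linear_vec_nth] by blast
  have "((\<lambda>x. \<Sum>f\<in>UNIV. (\<Prod>i\<in>UNIV. g i x $ f i) * ?c f) has_derivative
      (\<lambda>h. \<Sum>f\<in>UNIV. (\<Sum>j\<in>UNIV. g' j h $ f j * (\<Prod>i\<in>UNIV - {j}. g i x $ f i)) * ?c f)) (at x)"
    by (intro has_derivative_sum has_derivative_mult_left has_derivative_prod nth)
  moreover have "(\<Sum>f\<in>UNIV. (\<Sum>j\<in>UNIV. g' j h $ f j * (\<Prod>i\<in>UNIV - {j}. g i x $ f i)) * ?c f)
      = (\<Sum>j\<in>UNIV. \<omega> ((\<lambda>i. g i x)(j := g' j h)))" for h
  proof -
    have "(\<Prod>i\<in>UNIV. ((\<lambda>i. g i x)(j := g' j h)) i $ f i) = g' j h $ f j * (\<Prod>i\<in>UNIV - {j}. g i x $ f i)" for j f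
      by (subst prod.remove[of _ j]) (auto intro!: prod.cong)
    then show ?thesis
      unfolding covector_expand[OF \<omega>, of "_(_ := _)"] sum_distrib_right by (subst sum.swap) simp
  qed
  ultimately show ?thesis unfolding covector_expand[OF \<omega>, of "\<lambda>i. g i _"] by simp
qed

lemma covector_tendsto:
  fixes \<omega> :: "('n::finite \<Rightarrow> real^'m::finite) \<Rightarrow> real"
  assumes \<omega>: "covector \<omega>" and g: "\<And>i. (g i \<longlongrightarrow> l i) F"
  shows "((\<lambda>x. \<omega> (\<lambda>i. g i x)) \<longlongrightarrow> \<omega> l) F"
  unfolding covector_expand[OF \<omega>, of "\<lambda>i. g i _"] covector_expand[OF \<omega>, of l]
  by (intro tendsto_intros g)

lemma covector_continuous_on:
  fixes \<omega> :: "('n::finite \<Rightarrow> real^'m::finite) \<Rightarrow> real"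
  assumes "covector \<omega>" and "\<And>i. continuous_on S (g i)"
  shows "continuous_on S (\<lambda>x. \<omega> (\<lambda>i. g i x))"
  using assms unfolding continuous_on_def by (auto intro: covector_tendsto)

text \<open>Polarisation: \<open>\<omega>\<close> vanishes when \<open>a + b\<close> stands in both
  slots, and expanding leaves only the two mixed terms.\<close>

lemma covector_swap:
  fixes \<omega> :: "('n::finite \<Rightarrow> real^'m::finite) \<Rightarrow> real"
  assumes \<omega>: "covector \<omega>" and ij: "i \<noteq> j"
  shows "\<omega> (v(i := a, j := b)) = - \<omega> (v(i := b, j := a))"
proof -
  have alt: "\<omega> (v(i := c, j := c)) = 0" for c
    using \<omega> ij unfolding covector_def by (metis fun_upd_apply)
  note l2 = linear_add[OF covector_linear[OF \<omega>]]
  have l1: "\<omega> (v(i := c + d, j := e)) = \<omega> (v(i := c, j := e)) + \<omega> (v(i := d, j := e))" for c d e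
    using l2[of "v(j := e)" i c d] ij by (simp add: fun_upd_twist)
  have "0 = \<omega> (v(i := a + b, j := a + b))" using alt by simp
  also have "\<dots> = \<omega> (v(i := a, j := a)) + \<omega> (v(i := a, j := b)) + (\<omega> (v(i := b, j := a)) + \<omega> (v(i := b, j := b)))"
    by (simp add: l1 l2)
  finally show ?thesis by (simp add: alt)
qed

lemma calibration_le_1:
  fixes \<omega> :: "('n::finite \<Rightarrow> real^'m::finite) \<Rightarrow> real"
  assumes "calibration \<omega>" "\<And>i. norm (v i) = 1"
  shows "\<omega> v \<le> 1"
proof -
  have \<omega>: "covector \<omega>" and c: "Sup {\<omega> v | v. \<forall>i. norm (v i) = 1} = 1"
    using assms(1) by (auto simp: calibration_def comass_def)
  obtain C where C: "\<And>v. \<bar>\<omega> v\<bar> \<le> C * (\<Prod>i\<in>UNIV. norm (v i))" using covector_bound[OF \<omega>] by blast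
  have "bdd_above {\<omega> v | v. \<forall>i. norm (v i) = 1}"
  proof (rule bdd_aboveI)
    fix r assume "r \<in> {\<omega> v | v. \<forall>i. norm (v i) = 1}"
    then obtain v where "r = \<omega> v" "\<And>i. norm (v i) = 1" by auto
    then show "r \<le> C" using C[of v] by simp
  qed
  then have "\<omega> v \<le> Sup {\<omega> v | v. \<forall>i. norm (v i) = 1}"
    using assms(2) by (intro cSup_upper) auto
  then show ?thesis using c by simp
qed

text \<open>
  The comass bound \<open>\<omega>(L e\<^sub>1, \<dots>, y, \<dots>, L e\<^sub>n) \<le> |y|\<close> is attained at the unit vector \<open>y = L e\<^sub>i\<close>, so that
  vector represents the functional \<open>y \<mapsto> \<omega>(L e\<^sub>1, \<dots>, y, \<dots>, L e\<^sub>n)\<close>.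
\<close>

lemma calibration_cofactor:
  fixes \<omega> :: "('n::finite \<Rightarrow> real^'m::finite) \<Rightarrow> real"
  assumes \<omega>: "calibration \<omega>" and L: "L \<in> SO_cal \<omega>"
  shows "\<omega> ((\<lambda>k. L (axis k 1))(i := y)) = L (axis i 1) \<bullet> y"
proof -
  have \<omega>': "covector \<omega>" using \<omega> by (simp add: calibration_def)
  let ?v = "\<lambda>k. L (axis k 1)"
  define T where "T y = \<omega> (?v(i := y))" for y
  have T: "linear T" unfolding T_def[abs_def] by (rule covector_linear[OF \<omega>'])
  have nL: "norm (L x) = norm x" for x using L by (simp add: SO_cal_def)
  have le: "T y \<le> norm y" for y
  proof (cases "y = 0")
    case True
    then show ?thesis using linear_0[OF T] by simp
  next
    case False
    have "\<omega> (?v(i := y /\<^sub>R norm y)) \<le> 1"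
      using False by (intro calibration_le_1[OF \<omega>]) (simp add: nL)
    then have "T (y /\<^sub>R norm y) \<le> 1" by (simp add: T_def)
    then show ?thesis using False by (simp add: linear_scale[OF T] field_simps)
  qed
  have one: "T (?v i) = 1"
  proof -
    have "T (?v i) = pullback L \<omega> (\<lambda>k. axis k 1)" unfolding T_def pullback_def by (rule arg_cong[of _ _ \<omega>]) auto
    also have "\<dots> = vol_form (\<lambda>k::'n. axis k 1)" using L by (simp add: SO_cal_def)
    also have "\<dots> = det (mat 1 :: real^'n^'n)"
      unfolding vol_form_def by (intro arg_cong[of _ _ det]) (auto simp: vec_eq_iff mat_def axis_def)
    finally show ?thesis by simp
  qed
  define t :: "real^'m" where "t = (\<chi> k. T (axis k 1))"
  have rep: "T y = t \<bullet> y" for y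
  proof -
    have "T y = T (\<Sum>k\<in>UNIV. (y $ k) *\<^sub>R axis k 1)" by (simp only: axis_rep)
    then show ?thesis by (simp add: linear_sum[OF T] linear_scale[OF T] t_def inner_vec_def mult.commute)
  qed
  \<comment> \<open>Equality case of Cauchy-Schwarz: the comass bound at \<open>t\<close> itself
    gives |t| <= 1; since L e_i is a unit vector whose inner product with \<open>t\<close> is 1, the
    squared distance between them is at most 0.\<close>
  have "norm t * norm t \<le> norm t" using le[of t] by (simp add: rep dot_square_norm power2_eq_square)
  then have "norm t \<le> 1" by (cases "norm t = 0") (auto simp: mult_le_cancel_left)
  then have "t \<bullet> t \<le> 1" by (simp add: dot_square_norm power_le_one)
  moreover have "?v i \<bullet> ?v i = 1" using nL[of "axis i 1"] by (simp add: dot_square_norm)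
  moreover have "t \<bullet> ?v i = 1" using one rep by simp
  ultimately have "(?v i - t) \<bullet> (?v i - t) \<le> 0"
    by (simp add: inner_diff inner_commute)
  then have "(?v i - t) \<bullet> (?v i - t) = 0"
    by (intro antisym inner_ge_zero)
  then have "?v i = t" by simp
  then show ?thesis using rep[of y] by (simp add: T_def)
qed

lemma onorm_scaled_isometry:
  fixes L :: "real^'n::finite \<Rightarrow> 'b::real_normed_vector"
  assumes "linear L" "\<And>x. norm (L x) = norm x" "r \<ge> 0"
  shows "onorm (\<lambda>x. r *\<^sub>R L x) = r"
proof (rule antisym)
  have bl: "bounded_linear (\<lambda>x. r *\<^sub>R L x)"
    using assms(1) by (intro bounded_linear_scaleR_right[THEN bounded_linear_compose]) (simp add: linear_conv_bounded_linear)
  show "onorm (\<lambda>x. r *\<^sub>R L x) \<le> r" by (rule onorm_le) (use assms in simp)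
  \<comment> \<open>\<open>undefined\<close> only selects some coordinate direction; any unit vector
    would serve.\<close>
  have "norm (r *\<^sub>R L (axis undefined 1)) \<le> onorm (\<lambda>x. r *\<^sub>R L x) * norm (axis undefined (1::real) :: real^'n)"
    by (rule onorm[OF bl])
  then show "r \<le> onorm (\<lambda>x. r *\<^sub>R L x)" using assms by simp
qed

section \<open>Harmonicity of curves with constant dilation\<close>

text \<open>Slot \<open>i\<close> is not scaled, hence the exponent n-1. With \<open>w\<close> in
  slot \<open>i\<close> of the partials c L e_j, this factor times L e_i is c^(n-2) times the i-th
  partial.\<close>

lemma covector_scale_others:
  fixes \<omega> :: "('n::finite \<Rightarrow> real^'m::finite) \<Rightarrow> real"
  assumes \<omega>: "covector \<omega>"
  shows "\<omega> ((\<lambda>j. c *\<^sub>R v j)(i := w)) = c ^ (CARD('n) - 1) * \<omega> (v(i := w))"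
proof -
  have "(\<Prod>j\<in>UNIV. ((\<lambda>j. c *\<^sub>R v j)(i := w)) j $ f j) = c ^ (CARD('n) - 1) * (\<Prod>j\<in>UNIV. (v(i := w)) j $ f j)" for f
  proof -
    have "(\<Prod>j\<in>UNIV - {i}. ((\<lambda>j. c *\<^sub>R v j)(i := w)) j $ f j) = (\<Prod>j\<in>UNIV - {i}. c * v j $ f j)"
      "(\<Prod>j\<in>UNIV - {i}. (v(i := w)) j $ f j) = (\<Prod>j\<in>UNIV - {i}. v j $ f j)"
      by (auto intro!: prod.cong)
    then show ?thesis
      by (subst (1 2) prod.remove[of _ i]) (auto simp: prod.distrib card_Diff_singleton)
  qed
  then show ?thesis
    unfolding covector_expand[OF \<omega>, of "_(_ := _)"] by (simp add: sum_distrib_left mult.assoc)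
qed

lemma inverse_Suc_at_right_0:
  assumes "d > 0"
  shows "filterlim (\<lambda>n. d * inverse (real (Suc n))) (at_right 0) sequentially"
proof -
  have "(\<lambda>n. d * inverse (real (Suc n))) \<longlonglongrightarrow> d * 0"
    by (intro tendsto_mult tendsto_const LIMSEQ_inverse_real_of_nat)
  then show ?thesis
    using assms unfolding filterlim_at by (auto intro!: always_eventually)
qed

lemma test_function_integrable_scaleR:
  fixes h :: "'a::euclidean_space \<Rightarrow> 'b::euclidean_space"
  assumes "test_function \<Omega> \<phi>" "integrable lebesgue h"
  shows "integrable lebesgue (\<lambda>x. \<phi> x *\<^sub>R h x)"
proof -
  obtain M where "\<And>x. \<bar>\<phi> x\<bar> \<le> M" using test_function_bounded[OF assms(1)] by metis
  then show ?thesis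
    using assms by (intro integrable_bounded_scaleR[where M = M] continuous_borel_lebesgue test_function_continuous)
qed

lemma test_function_integrable_mult:
  fixes h :: "'a::euclidean_space \<Rightarrow> real"
  assumes "test_function \<Omega> \<phi>" "continuous_on UNIV h"
  shows "integrable lebesgue (\<lambda>x. \<phi> x * h x)"
proof (rule continuous_compact_support_integrable[where K = "closure {x. \<phi> x \<noteq> 0}"])
  show "continuous_on UNIV (\<lambda>x. \<phi> x * h x)"
    by (intro continuous_on_mult test_function_continuous[OF assms(1)] assms(2))
  show "compact (closure {x. \<phi> x \<noteq> 0})" using assms(1) by (simp add: test_function_def)
  show "\<phi> x * h x = 0" if "x \<notin> closure {x. \<phi> x \<noteq> 0}" for x
    using outside_support[OF that] by simp
qed

text \<open>The problem localised to a ball: \<open>f\<close> and \<open>g i\<close> stand for the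
  curve and its partials, extended by zero so that convolution over the whole space makes sense. The
  differential relations hold only on the ball, while \<open>g_bound\<close> holds almost everywhere
  in space and so survives mollification at every point.\<close>

locale dilation_ball =
  fixes \<omega> :: "('n::finite \<Rightarrow> real^'m::finite) \<Rightarrow> real"
    and f :: "real^'n \<Rightarrow> real^'m" and g :: "'n \<Rightarrow> real^'n \<Rightarrow> real^'m"
    and x0 :: "real^'n" and R c :: real
  assumes calib: "calibration \<omega>" and R: "R > 0" and c0: "c \<ge> 0"
    and f: "integrable lebesgue f" and g: "\<And>i. integrable lebesgue (g i)"
    and weak: "\<And>\<phi> i. test_function (ball x0 R) \<phi> \<Longrightarrow>
      (LINT x|lebesgue. dird (axis i 1) \<phi> x *\<^sub>R f x) = - (LINT x|lebesgue. \<phi> x *\<^sub>R g i x)"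
    and CO: "AE x in lebesgue. x \<in> ball x0 R \<longrightarrow> (\<exists>L\<in>SO_cal \<omega>. \<forall>i. g i x = c *\<^sub>R L (axis i 1))"
    and g_bound: "\<And>i. AE x in lebesgue. norm (g i x) \<le> c"
begin

abbreviation e :: "'n \<Rightarrow> real^'n" where "e i \<equiv> axis i 1"

lemma cov: "covector \<omega>" using calib by (simp add: calibration_def)

lemma dist_corner:
  fixes x z :: "real^'n"
  assumes "\<epsilon> > 0" "z \<in> cbox (- \<epsilon> *\<^sub>R One) 0"
  shows "dist x (x - z) \<le> \<epsilon> * real CARD('n)"
proof -
  have "x - z \<in> cbox x (x + \<epsilon> *\<^sub>R One)"
    using assms(2) by (auto simp: mem_box inner_simps algebra_simps)
  from norm_cbox_corner[OF this assms(1)] show ?thesis by (simp add: dist_norm norm_minus_commute)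
qed

text \<open>Kernels with the support of \<open>moll \<epsilon>\<close>. The class is closed under
  \<open>dird\<close>, so the same support estimate serves the mollifier and all its
  derivatives.\<close>

definition corner_test :: "real \<Rightarrow> (real^'n \<Rightarrow> real) \<Rightarrow> bool" where
  "corner_test \<epsilon> \<phi> \<longleftrightarrow> test_function UNIV \<phi> \<and> (\<forall>z. z \<notin> cbox (- \<epsilon> *\<^sub>R One) 0 \<longrightarrow> \<phi> z = 0)"

lemma corner_test_moll: "\<epsilon> > 0 \<Longrightarrow> corner_test \<epsilon> (moll \<epsilon>)"
  by (auto simp: corner_test_def moll_test moll_outside)

lemma corner_test_dird:
  assumes "corner_test \<epsilon> \<phi>"
  shows "corner_test \<epsilon> (dird v \<phi>)"
  unfolding corner_test_def
proof (intro conjI allI impI)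
  show "test_function UNIV (dird v \<phi>)" using assms by (simp add: corner_test_def test_function_dird)
  show "dird v \<phi> z = 0" if "z \<notin> cbox (- \<epsilon> *\<^sub>R One) 0" for z
    by (rule dird_eq_0[where S = "- cbox (- \<epsilon> *\<^sub>R One) 0"]) (use assms that in \<open>auto simp: corner_test_def\<close>)
qed

lemma corner_test_function: "corner_test \<epsilon> \<phi> \<Longrightarrow> test_function UNIV \<phi>"
  by (simp add: corner_test_def)

lemma corner_test_reflect:
  assumes "corner_test \<epsilon> \<phi>" "\<epsilon> > 0" "dist x0 x + \<epsilon> * real CARD('n) < r"
  shows "test_function (ball x0 r) (\<lambda>y. \<phi> (x - y))"
proof (rule test_function_reflect[where K = "cbox (- \<epsilon> *\<^sub>R One) 0"])
  show "x - z \<in> ball x0 r" if "z \<in> cbox (- \<epsilon> *\<^sub>R One) 0" for z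
    using dist_corner[OF assms(2) that, of x] dist_triangle[of x0 "x - z" x] assms(3) by simp
qed (use assms in \<open>auto simp: corner_test_def\<close>)

text \<open>The weak identity is tested with the reflected kernel; the sign from reflection cancels
  the sign in the definition of the weak derivative.\<close>

lemma conv_weak:
  assumes "corner_test \<epsilon> \<phi>" "\<epsilon> > 0" "dist x0 x + \<epsilon> * real CARD('n) < R"
  shows "conv (dird (e i) \<phi>) f x = conv \<phi> (g i) x"
  using weak[OF corner_test_reflect[OF assms], of i]
  by (simp add: dird_reflect[OF corner_test_function[OF assms(1)]] conv_def)

text \<open>The k-th partial of the mollified map, with the derivative on the kernel. It is
  differentiable on all of space, unlike what is known of \<open>g k\<close>, and agrees with the
  mollified \<open>g k\<close> well inside the ball.\<close>

abbreviation H :: "real \<Rightarrow> 'n \<Rightarrow> real^'n \<Rightarrow> real^'m" where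
  "H \<epsilon> k \<equiv> conv (dird (e k) (moll \<epsilon>)) f"

abbreviation H2 :: "real \<Rightarrow> 'n \<Rightarrow> real^'n \<Rightarrow> real^'n \<Rightarrow> real^'m" where
  "H2 \<epsilon> k v \<equiv> conv (dird v (dird (e k) (moll \<epsilon>))) f"

lemma H_deriv: "\<epsilon> > 0 \<Longrightarrow> (H \<epsilon> k has_derivative (\<lambda>v. H2 \<epsilon> k v x)) (at x)"
  by (intro conv_has_derivative[where \<Omega> = UNIV] test_function_dird moll_test f)

lemma H_cont: "\<epsilon> > 0 \<Longrightarrow> continuous_on UNIV (H \<epsilon> k)"
  by (intro conv_continuous[where \<Omega> = UNIV] test_function_dird moll_test f)

lemma H2_cont: "\<epsilon> > 0 \<Longrightarrow> continuous_on UNIV (H2 \<epsilon> k v)"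
  by (intro conv_continuous[where \<Omega> = UNIV] test_function_dird moll_test f)

lemma test_function_ball_outside: "test_function (ball x0 r) \<phi> \<Longrightarrow> x \<notin> ball x0 r \<Longrightarrow> \<phi> x = 0"
  unfolding test_function_def using closure_subset[of "{x. \<phi> x \<noteq> 0}"] by blast

lemma compose_g_measurable:
  fixes \<Phi> :: "real^'m^'n \<Rightarrow> real"
  assumes \<Phi>: "continuous_on UNIV \<Phi>"
  shows "(\<lambda>x. \<Phi> (\<chi> j. g j x)) \<in> borel_measurable lebesgue"
proof (rule measurable_compose[where f = "\<lambda>x. \<chi> j. g j x" and g = \<Phi> and N = borel])
  show "\<Phi> \<in> borel_measurable borel" using \<Phi> by (rule borel_measurable_continuous_onI)
  have "(\<lambda>x. (\<chi> j. g j x) \<bullet> b) \<in> borel_measurable lebesgue" for b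
  proof -
    have "(\<lambda>x. (\<chi> j. g j x) \<bullet> b) = (\<lambda>x. \<Sum>j\<in>UNIV. g j x \<bullet> b $ j)"
      by (rule ext) (subst inner_vec_def, simp)
    then show ?thesis using borel_measurable_integrable[OF g] by simp
  qed
  then show "(\<lambda>x. \<chi> j. g j x) \<in> borel_measurable lebesgue"
    by (subst borel_measurable_euclidean_space) auto
qed

text \<open>Dominated convergence: the mollified partials stay bounded by \<open>c\<close>, so
  \<open>\<Phi>\<close> is evaluated on a compact set, and they converge almost everywhere. A
  general \<open>\<Phi>\<close> covers \<open>\<omega>\<close> with one frozen slot, the squared
  length of a row, and a component of a row.\<close>

lemma conv_limit:
  fixes \<Phi> :: "real^'m^'n \<Rightarrow> real"
  assumes \<psi>: "test_function (ball x0 r) \<psi>" and \<Phi>: "continuous_on UNIV \<Phi>"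
    and \<epsilon>: "\<And>n. \<epsilon> n > 0" "filterlim \<epsilon> (at_right 0) sequentially"
  shows "(\<lambda>n. LINT x|lebesgue. \<psi> x * \<Phi> (\<chi> j. conv (moll (\<epsilon> n)) (g j) x)) \<longlonglongrightarrow>
      (LINT x|lebesgue. \<psi> x * \<Phi> (\<chi> j. g j x))"
proof -
  \<comment> \<open>A matrix whose rows have norm at most \<open>c\<close> has norm at most the sum
    of the row norms, hence the radius.\<close>
  have "compact (\<Phi> ` cball 0 (real CARD('n) * c))"
    by (intro compact_continuous_image continuous_on_subset[OF \<Phi>]) auto
  then obtain C where C: "\<And>y. y \<in> \<Phi> ` cball 0 (real CARD('n) * c) \<Longrightarrow> norm y \<le> C"
    using compact_imp_bounded bounded_iff by metis
  have bd: "\<bar>\<Phi> V\<bar> \<le> C" if "\<And>j. norm (V $ j) \<le> c" for V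
  proof -
    have "norm V \<le> (\<Sum>j\<in>UNIV. norm (V $ j))" by (simp add: norm_vec_def L2_set_le_sum)
    also have "\<dots> \<le> (\<Sum>j\<in>(UNIV::'n set). c)" by (intro sum_mono that)
    finally have "norm V \<le> real CARD('n) * c" by simp
    then show ?thesis using C[of "\<Phi> V"] by simp
  qed
  have cont: "continuous_on UNIV (\<lambda>x. \<Phi> (\<chi> j. conv (moll (\<epsilon> n)) (g j) x))" for n
    using \<epsilon>(1)[of n]
    by (intro continuous_on_compose2[OF \<Phi>] continuous_intros conv_continuous[OF moll_test g]) auto
  have lim: "AE x in lebesgue. (\<lambda>n. \<psi> x * \<Phi> (\<chi> j. conv (moll (\<epsilon> n)) (g j) x)) \<longlonglongrightarrow> \<psi> x * \<Phi> (\<chi> j. g j x)"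
  proof -
    have "AE x in lebesgue. \<forall>j\<in>(UNIV::'n set). ((\<lambda>\<epsilon>. conv (moll \<epsilon>) (g j) x) \<longlongrightarrow> g j x) (at_right 0)"
      by (intro AE_finite_allI conv_moll_tendsto_AE g) auto
    then show ?thesis
    proof eventually_elim
      case (elim x)
      then have "(\<lambda>n. \<chi> j. conv (moll (\<epsilon> n)) (g j) x) \<longlonglongrightarrow> (\<chi> j. g j x)"
        by (intro tendsto_vec_lambda) (auto intro: filterlim_compose[OF _ \<epsilon>(2)])
      then have "(\<lambda>n. \<Phi> (\<chi> j. conv (moll (\<epsilon> n)) (g j) x)) \<longlonglongrightarrow> \<Phi> (\<chi> j. g j x)"
        by (rule continuous_on_tendsto_compose[OF \<Phi>]) auto
      then show ?case by (intro tendsto_mult tendsto_const)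
    qed
  qed
  have c\<psi>: "continuous_on UNIV \<psi>" using \<psi> by (rule test_function_continuous)
  have meas: "(\<lambda>x. \<psi> x * \<Phi> (\<chi> j. conv (moll (\<epsilon> n)) (g j) x)) \<in> borel_measurable lebesgue" for n
    by (intro continuous_borel_lebesgue continuous_intros c\<psi> cont)
  note compose_g_measurable[OF \<Phi>]
  then have meas': "(\<lambda>x. \<psi> x * \<Phi> (\<chi> j. g j x)) \<in> borel_measurable lebesgue"
    by (rule borel_measurable_times[OF continuous_borel_lebesgue[OF c\<psi>]])
  show ?thesis
  proof (rule integral_dominated_convergence[OF meas' meas _ lim])
    have "integrable lebesgue (\<lambda>x. \<psi> x * C)"
      using test_function_integrable_mult[OF \<psi>, of "\<lambda>_. C"] by simp
    then show "integrable lebesgue (\<lambda>x. \<bar>\<psi> x * C\<bar>)" by (rule integrable_abs)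
    show "AE x in lebesgue. norm (\<psi> x * \<Phi> (\<chi> j. conv (moll (\<epsilon> n)) (g j) x)) \<le> \<bar>\<psi> x * C\<bar>" for n
    proof (rule AE_I2)
      fix x
      have "\<bar>\<Phi> (\<chi> j. conv (moll (\<epsilon> n)) (g j) x)\<bar> \<le> C"
        by (rule bd) (simp add: conv_moll_bound[OF \<epsilon>(1) g g_bound])
      then show "norm (\<psi> x * \<Phi> (\<chi> j. conv (moll (\<epsilon> n)) (g j) x)) \<le> \<bar>\<psi> x * C\<bar>"
        by (auto simp: abs_mult intro!: mult_left_mono)
    qed
  qed
qed

text \<open>
  The field \<open>i \<mapsto> \<omega>(\<partial>\<^sub>1F, \<dots>, w, \<dots>, \<partial>\<^sub>nF)\<close> of a smooth map \<open>F\<close> is divergence free: second derivatives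
  are symmetric while \<open>\<omega>\<close> is alternating.
\<close>

lemma mollified_divergence_free:
  assumes \<phi>: "test_function (ball x0 r) \<phi>" and \<epsilon>: "\<epsilon> > 0" "r + \<epsilon> * real CARD('n) \<le> R"
  shows "(\<Sum>i\<in>UNIV. LINT x|lebesgue. dird (e i) \<phi> x * \<omega> ((\<lambda>j. conv (moll \<epsilon>) (g j) x)(i := w))) = 0"
proof -
  \<comment> \<open>\<open>H\<close> replaces the mollified \<open>g\<close> because it is
    differentiable everywhere. Slot \<open>i\<close> is frozen at the constant \<open>w\<close>, so
    its derivative in \<open>G'\<close> is 0.\<close>
  define G where "G i k x = (if k = i then w else H \<epsilon> k x)" for i k x
  define G' where "G' i k v x = (if k = i then 0 else H2 \<epsilon> k v x)" for i k v x
  define h where "h i x = \<omega> (\<lambda>k. G i k x)" for i x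
  define h' where "h' i v x = (\<Sum>j\<in>UNIV. \<omega> ((\<lambda>k. G i k x)(j := G' i j v x)))" for i v x
  have dG: "(G i k has_derivative (\<lambda>v. G' i k v x)) (at x)" for i k x
    by (cases "k = i") (auto simp: G_def[abs_def] G'_def H_deriv[OF \<epsilon>(1)])
  have dh: "(h i has_derivative (\<lambda>v. h' i v x)) (at x)" for i x
    unfolding h_def[abs_def] h'_def by (rule covector_has_derivative[OF cov dG])
  have cG: "continuous_on UNIV (G i k)" for i k
    by (cases "k = i") (auto simp: G_def[abs_def] H_cont[OF \<epsilon>(1)])
  have cG': "continuous_on UNIV (G' i k v)" for i k v
    by (cases "k = i") (auto simp: G'_def[abs_def] H2_cont[OF \<epsilon>(1)])
  have ch: "continuous_on UNIV (h i)" for i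
    unfolding h_def[abs_def] by (rule covector_continuous_on[OF cov cG])
  have ch': "continuous_on UNIV (h' i v)" for i v
    unfolding h'_def[abs_def]
  proof (intro continuous_on_sum)
    fix j
    have "continuous_on UNIV (\<lambda>x. if k = j then G' i j v x else G i k x)" for k
      by (cases "k = j") (auto simp: cG cG')
    from covector_continuous_on[OF cov this]
    show "continuous_on UNIV (\<lambda>x. \<omega> ((\<lambda>k. G i k x)(j := G' i j v x)))"
      by (simp add: fun_upd_def)
  qed
  have div0: "(\<Sum>i\<in>UNIV. h' i (e i) x) = 0" for x
  proof -
    \<comment> \<open>The term from differentiating slot \<open>j\<close> of the i-th component in
      direction \<open>e i\<close>. The matrix is antisymmetric: the diagonal contains the
      derivative of the constant \<open>w\<close>, and off the diagonal swapping the indices swaps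
      two arguments of \<open>\<omega>\<close>.\<close>
    define a where "a i j = \<omega> ((\<lambda>k. G i k x)(j := G' i j (e i) x))" for i j
    have a0: "a i i = 0" for i
      unfolding a_def G'_def using linear_0[OF covector_linear[OF cov]] by simp
    have aij: "a i j = \<omega> ((\<lambda>k. H \<epsilon> k x)(i := w, j := H2 \<epsilon> j (e i) x))" if "i \<noteq> j" for i j
      unfolding a_def using that by (intro arg_cong[of _ _ \<omega>]) (auto simp: G_def G'_def)
    have anti: "a i j = - a j i" for i j
    proof (cases "i = j")
      case False
      have "H2 \<epsilon> j (e i) x = H2 \<epsilon> i (e j) x" by (simp add: dird_moll_commute[of "e i"])
      then show ?thesis
        using covector_swap[OF cov False, of "\<lambda>k. H \<epsilon> k x" w "H2 \<epsilon> j (e i) x"] False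
        by (simp add: aij fun_upd_twist)
    qed (simp add: a0)
    have "(\<Sum>i\<in>UNIV. h' i (e i) x) = (\<Sum>i\<in>UNIV. \<Sum>j\<in>UNIV. a i j)"
      by (simp add: h'_def a_def)
    also have "\<dots> = (\<Sum>i\<in>UNIV. \<Sum>j\<in>UNIV. a j i)" by (rule sum.swap)
    also have "\<dots> = - (\<Sum>i\<in>UNIV. \<Sum>j\<in>UNIV. a i j)"
      by (subst anti) (simp add: sum_negf)
    finally show ?thesis by (simp add: h'_def a_def)
  qed
  have eq: "dird (e i) \<phi> x * h i x = dird (e i) \<phi> x * \<omega> ((\<lambda>j. conv (moll \<epsilon>) (g j) x)(i := w))" for i x
  proof (cases "x \<in> ball x0 r")
    case True
    then have "H \<epsilon> k x = conv (moll \<epsilon>) (g k) x" for k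
      using \<epsilon> by (intro conv_weak[of \<epsilon>] corner_test_moll) auto
    then show ?thesis unfolding h_def G_def fun_upd_def by presburger
  qed (simp add: test_function_ball_outside[OF test_function_dird[OF \<phi>]])
  have "(\<Sum>i\<in>UNIV. LINT x|lebesgue. dird (e i) \<phi> x * h i x) = - (\<Sum>i\<in>UNIV. LINT x|lebesgue. \<phi> x * h' i (e i) x)"
    by (simp add: integral_by_parts_dird[OF \<phi> dh ch'] sum_negf)
  also have "\<dots> = - (LINT x|lebesgue. (\<Sum>i\<in>UNIV. \<phi> x * h' i (e i) x))"
    by (subst Bochner_Integration.integral_sum) (auto intro: test_function_integrable_mult[OF \<phi> ch'])
  also have "\<dots> = 0" by (simp add: div0 flip: sum_distrib_left)
  finally show ?thesis by (simp add: eq)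
qed

section \<open>Weak harmonicity of the limit map\<close>

lemma test_inner_integrable:
  assumes "test_function \<Omega> \<phi>"
  shows "integrable lebesgue (\<lambda>x. \<phi> x * (g i x \<bullet> w))"
  using test_function_integrable_scaleR[OF assms integrable_inner_left[OF g[of i], of w]] by simp

lemma AE_g_zero: "c = 0 \<Longrightarrow> AE x in lebesgue. g i x = 0"
  using g_bound[of i] by (auto elim: eventually_mono)

lemma small_scales:
  assumes "r < R"
  obtains \<epsilon> where "\<And>n. \<epsilon> n > 0" "\<And>n. r + \<epsilon> n * real CARD('n) < R" "filterlim \<epsilon> (at_right 0) sequentially"
proof -
  \<comment> \<open>Half of the admissible scale, so that even the largest one, \<open>d\<close>
    itself, satisfies the strict inequality.\<close>
  define d where "d = (R - r) / (2 * real CARD('n))"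
  have d: "d > 0" using assms by (simp add: d_def)
  have dn: "2 * d * real CARD('n) = R - r" by (simp add: d_def)
  show ?thesis
  proof (rule that[OF _ _ inverse_Suc_at_right_0[OF d]])
    fix n
    show "d * inverse (real (Suc n)) > 0" using d by simp
    have "d * inverse (real (Suc n)) \<le> d" using d by (simp add: field_simps)
    then have "d * inverse (real (Suc n)) * real CARD('n) \<le> d * real CARD('n)" by (intro mult_right_mono) auto
    also have "\<dots> < R - r" using dn mult_pos_pos[OF d, of "real CARD('n)"] by simp
    finally show "r + d * inverse (real (Suc n)) * real CARD('n) < R" by simp
  qed
qed

text \<open>The divergence identity passes to the limit first; only then is the integrand identified
  with the partials through the cofactor identity, which is available for \<open>g\<close> but not
  for its mollification.\<close>

lemma harmonic:
  assumes \<phi>: "test_function (ball x0 r) \<phi>" and r: "r < R"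
  shows "(\<Sum>i\<in>UNIV. LINT x|lebesgue. dird (e i) \<phi> x *\<^sub>R g i x) = 0"
proof -
  note d\<phi> = test_function_dird[OF \<phi>]
  obtain \<epsilon> where \<epsilon>: "\<And>n. \<epsilon> n > 0" "\<And>n. r + \<epsilon> n * real CARD('n) < R" "filterlim \<epsilon> (at_right 0) sequentially"
    using small_scales[OF r] by metis
  have scalar: "(\<Sum>i\<in>UNIV. LINT x|lebesgue. dird (e i) \<phi> x * (g i x \<bullet> w)) = 0" for w
  proof (cases "c = 0")
    \<comment> \<open>For \<open>c = 0\<close> the partials vanish almost everywhere; this case is
      separate because the other one divides by \<open>c\<close>.\<close>
    case True
    have "(LINT x|lebesgue. dird (e i) \<phi> x * (g i x \<bullet> w)) = 0" for i
      by (rule integral_eq_zero_AE) (use AE_g_zero[OF True, of i] in \<open>auto elim: eventually_mono\<close>)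
    then show ?thesis by simp
  next
    case False
    let ?\<Phi> = "\<lambda>i (V::real^'m^'n). \<omega> ((\<lambda>j. V $ j)(i := w))"
    have cont: "continuous_on UNIV (?\<Phi> i)" for i
    proof -
      have "continuous_on UNIV (\<lambda>V::real^'m^'n. if j = i then w else V $ j)" for j
        by (cases "j = i") (auto intro: continuous_intros)
      from covector_continuous_on[OF cov this] show ?thesis by (simp add: fun_upd_def)
    qed
    have "(\<lambda>n. \<Sum>i\<in>UNIV. LINT x|lebesgue. dird (e i) \<phi> x * ?\<Phi> i (\<chi> j. conv (moll (\<epsilon> n)) (g j) x)) \<longlonglongrightarrow>
        (\<Sum>i\<in>UNIV. LINT x|lebesgue. dird (e i) \<phi> x * ?\<Phi> i (\<chi> j. g j x))"
      by (intro tendsto_sum conv_limit[OF d\<phi> cont \<epsilon>(1,3)])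
    moreover have "(\<Sum>i\<in>UNIV. LINT x|lebesgue. dird (e i) \<phi> x * ?\<Phi> i (\<chi> j. conv (moll (\<epsilon> n)) (g j) x)) = 0" for n
      using mollified_divergence_free[OF \<phi> \<epsilon>(1), of n w] \<epsilon>(2)[of n] by (simp add: less_imp_le)
    ultimately have lim0: "(\<Sum>i\<in>UNIV. LINT x|lebesgue. dird (e i) \<phi> x * ?\<Phi> i (\<chi> j. g j x)) = 0"
      by (simp add: LIMSEQ_const_iff)
    \<comment> \<open>The factor c^(n-2) of the overview, written as a quotient; it is nonzero and
      can be cancelled.\<close>
    let ?q = "c ^ (CARD('n) - 1) / c"
    have "(LINT x|lebesgue. dird (e i) \<phi> x * ?\<Phi> i (\<chi> j. g j x))
        = (LINT x|lebesgue. ?q * (dird (e i) \<phi> x * (g i x \<bullet> w)))" for i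
    proof (rule integral_cong_AE)
      have "AE x in lebesgue. dird (e i) \<phi> x * ?\<Phi> i (\<chi> j. g j x) = ?q * (dird (e i) \<phi> x * (g i x \<bullet> w))"
        using CO
      proof eventually_elim
        case (elim x)
        show ?case
        proof (cases "x \<in> ball x0 R")
          case True
          then obtain L where L: "L \<in> SO_cal \<omega>" "\<And>i. g i x = c *\<^sub>R L (e i)" using elim by blast
          have "?\<Phi> i (\<chi> j. g j x) = c ^ (CARD('n) - 1) * (L (e i) \<bullet> w)"
            using covector_scale_others[OF cov, of c "\<lambda>j. L (e j)" i w] calibration_cofactor[OF calib L(1), of i w]
            by (simp add: L(2))
          then show ?thesis using False by (simp add: L(2))
        next
          case False
          then have "x \<notin> ball x0 r" using r by auto
          then show ?thesis using test_function_ball_outside[OF d\<phi>] by simp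
        qed
      qed
      then show "AE x in lebesgue. dird (e i) \<phi> x * ?\<Phi> i (\<chi> j. g j x) = ?q * (dird (e i) \<phi> x * (g i x \<bullet> w))" .
      show m2: "(\<lambda>x. ?q * (dird (e i) \<phi> x * (g i x \<bullet> w))) \<in> borel_measurable lebesgue"
        using test_inner_integrable[OF d\<phi>] by (intro borel_measurable_integrable integrable_mult_right) auto
      show "(\<lambda>x. dird (e i) \<phi> x * ?\<Phi> i (\<chi> j. g j x)) \<in> borel_measurable lebesgue"
        by (intro borel_measurable_times compose_g_measurable cont continuous_borel_lebesgue test_function_continuous[OF d\<phi>])
    qed
    then have "?q * (\<Sum>i\<in>UNIV. LINT x|lebesgue. dird (e i) \<phi> x * (g i x \<bullet> w)) = 0"
      using lim0 by (simp add: sum_distrib_left)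
    then show ?thesis using False by simp
  qed
  let ?I = "\<Sum>i\<in>UNIV. LINT x|lebesgue. dird (e i) \<phi> x *\<^sub>R g i x"
  have "?I \<bullet> w = 0" for w
    using scalar[of w] test_function_integrable_scaleR[OF d\<phi> g]
    by (simp add: inner_sum_left flip: integral_inner_left)
  from this[of ?I] show ?thesis by simp
qed

text \<open>One derivative passes to \<open>g i\<close> by \<open>conv_weak\<close>, and the other
  is read as the derivative of a reflected test function, to which \<open>harmonic\<close> applies.
  Arbitrary corner kernels are allowed so that derivatives of the mollified map are covered
  too.\<close>

lemma conv_laplacian:
  assumes \<phi>: "corner_test \<epsilon> \<phi>" and \<epsilon>: "\<epsilon> > 0" "dist x0 x + \<epsilon> * real CARD('n) < R"
  shows "(\<Sum>i\<in>UNIV. conv (dird (e i) (dird (e i) \<phi>)) f x) = 0"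
proof -
  \<comment> \<open>\<open>harmonic\<close> needs a radius strictly below \<open>R\<close>, so one
    is inserted.\<close>
  obtain r where r: "dist x0 x + \<epsilon> * real CARD('n) < r" "r < R" using dense[OF \<epsilon>(2)] by blast
  have "(\<Sum>i\<in>UNIV. conv (dird (e i) (dird (e i) \<phi>)) f x) = (\<Sum>i\<in>UNIV. conv (dird (e i) \<phi>) (g i) x)"
    using conv_weak[OF corner_test_dird[OF \<phi>] \<epsilon>] by simp
  also have "\<dots> = - (\<Sum>i\<in>UNIV. LINT y|lebesgue. dird (e i) (\<lambda>y. \<phi> (x - y)) y *\<^sub>R g i y)"
    by (simp add: conv_def dird_reflect[OF corner_test_function[OF \<phi>]] sum_negf)
  also have "\<dots> = 0"
    using harmonic[OF corner_test_reflect[OF \<phi> \<epsilon>(1) r(1)] r(2)] by simp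
  finally show ?thesis .
qed

text \<open>Both derivatives of \<open>\<psi>\<close> are moved onto |H|^2. This yields twice |H2|^2
  plus twice the product of \<open>H\<close> with its Laplacian, and the Laplacian vanishes on the
  support of \<open>\<psi>\<close>.\<close>

lemma mollified_Bochner:
  assumes \<psi>: "test_function (ball x0 r) \<psi>" and \<epsilon>: "\<epsilon> > 0" "r + \<epsilon> * real CARD('n) \<le> R"
  shows "(\<Sum>i\<in>UNIV. LINT x|lebesgue. dird (e i) (dird (e i) \<psi>) x * (conv (moll \<epsilon>) (g k) x \<bullet> conv (moll \<epsilon>) (g k) x))
    = 2 * (\<Sum>i\<in>UNIV. LINT x|lebesgue. \<psi> x * (H2 \<epsilon> k (e i) x \<bullet> H2 \<epsilon> k (e i) x))"
proof -
  note d\<psi> = test_function_dird[OF \<psi>]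
  let ?\<phi> = "dird (e k) (moll \<epsilon>) :: real^'n \<Rightarrow> real"
  have ml: "corner_test \<epsilon> ?\<phi>" using \<epsilon>(1) by (intro corner_test_dird corner_test_moll)
  define H3 where "H3 i v = conv (dird v (dird (e i) ?\<phi>)) f" for i v
  have dH2: "(H2 \<epsilon> k (e i) has_derivative (\<lambda>v. H3 i v x)) (at x)" for i x
    unfolding H3_def by (intro conv_has_derivative[where \<Omega> = UNIV] test_function_dird moll_test f \<epsilon>)
  have cH3: "continuous_on UNIV (H3 i v)" for i v
    unfolding H3_def by (intro conv_continuous[where \<Omega> = UNIV] test_function_dird moll_test f \<epsilon>)
  note cH = H_cont[OF \<epsilon>(1)] and cH2 = H2_cont[OF \<epsilon>(1)]
  have onb: "H \<epsilon> k x = conv (moll \<epsilon>) (g k) x" if "x \<in> ball x0 r" for x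
    using that \<epsilon> by (intro conv_weak[of \<epsilon>] corner_test_moll) auto
  have lap: "(\<Sum>i\<in>UNIV. H3 i (e i) x) = 0" if "x \<in> ball x0 r" for x
    unfolding H3_def using that \<epsilon> by (intro conv_laplacian[OF ml]) auto
  \<comment> \<open>Holds for each direction separately; the third-derivative terms cancel only
    after summation over \<open>i\<close>.\<close>
  have first: "(LINT x|lebesgue. dird (e i) (dird (e i) \<psi>) x * (conv (moll \<epsilon>) (g k) x \<bullet> conv (moll \<epsilon>) (g k) x))
      = 2 * (LINT x|lebesgue. \<psi> x * (H2 \<epsilon> k (e i) x \<bullet> H2 \<epsilon> k (e i) x))
      + 2 * (LINT x|lebesgue. \<psi> x * (H \<epsilon> k x \<bullet> H3 i (e i) x))" for i
  proof -
    have "(LINT x|lebesgue. dird (e i) (dird (e i) \<psi>) x * (conv (moll \<epsilon>) (g k) x \<bullet> conv (moll \<epsilon>) (g k) x))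
        = (LINT x|lebesgue. dird (e i) (dird (e i) \<psi>) x * (H \<epsilon> k x \<bullet> H \<epsilon> k x))"
    proof (intro Bochner_Integration.integral_cong refl)
      fix x
      show "dird (e i) (dird (e i) \<psi>) x * (conv (moll \<epsilon>) (g k) x \<bullet> conv (moll \<epsilon>) (g k) x)
          = dird (e i) (dird (e i) \<psi>) x * (H \<epsilon> k x \<bullet> H \<epsilon> k x)"
        by (cases "x \<in> ball x0 r") (simp_all add: onb test_function_ball_outside[OF test_function_dird[OF d\<psi>]])
    qed
    also have "\<dots> = - (LINT x|lebesgue. dird (e i) \<psi> x * (H \<epsilon> k x \<bullet> H2 \<epsilon> k (e i) x + H2 \<epsilon> k (e i) x \<bullet> H \<epsilon> k x))"
      by (subst integral_by_parts_dird[OF d\<psi>, of "\<lambda>x. H \<epsilon> k x \<bullet> H \<epsilon> k x" "\<lambda>v x. H \<epsilon> k x \<bullet> H2 \<epsilon> k v x + H2 \<epsilon> k v x \<bullet> H \<epsilon> k x"])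
        (use cH cH2 in \<open>auto intro!: has_derivative_inner H_deriv \<epsilon> continuous_on_add continuous_on_inner\<close>)
    also have "\<dots> = - (2 * (LINT x|lebesgue. dird (e i) \<psi> x * (H \<epsilon> k x \<bullet> H2 \<epsilon> k (e i) x)))"
      by (subst inner_commute[of "H2 \<epsilon> k (e i) _"]) (simp add: distrib_left flip: mult_2 integral_mult_right_zero, simp add: algebra_simps)
    also have "\<dots> = 2 * (LINT x|lebesgue. \<psi> x * (H \<epsilon> k x \<bullet> H3 i (e i) x + H2 \<epsilon> k (e i) x \<bullet> H2 \<epsilon> k (e i) x))"
      by (subst integral_by_parts_dird[OF \<psi>, of "\<lambda>x. H \<epsilon> k x \<bullet> H2 \<epsilon> k (e i) x" "\<lambda>v x. H \<epsilon> k x \<bullet> H3 i v x + H2 \<epsilon> k v x \<bullet> H2 \<epsilon> k (e i) x"])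
        (use cH cH2 cH3 in \<open>auto intro!: has_derivative_inner H_deriv dH2 \<epsilon> continuous_on_add continuous_on_inner\<close>)
    also have "\<dots> = 2 * ((LINT x|lebesgue. \<psi> x * (H \<epsilon> k x \<bullet> H3 i (e i) x)) + (LINT x|lebesgue. \<psi> x * (H2 \<epsilon> k (e i) x \<bullet> H2 \<epsilon> k (e i) x)))"
      unfolding distrib_left
      by (subst Bochner_Integration.integral_add)
        (use cH cH2 cH3 in \<open>auto intro!: test_function_integrable_mult[OF \<psi>] continuous_on_inner simp: distrib_left\<close>)
    finally show ?thesis by simp
  qed
  have "(\<Sum>i\<in>UNIV. LINT x|lebesgue. \<psi> x * (H \<epsilon> k x \<bullet> H3 i (e i) x))
      = (LINT x|lebesgue. (\<Sum>i\<in>UNIV. \<psi> x * (H \<epsilon> k x \<bullet> H3 i (e i) x)))"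
    by (subst Bochner_Integration.integral_sum)
      (use cH cH3 in \<open>auto intro!: test_function_integrable_mult[OF \<psi>] continuous_on_inner\<close>)
  also have "(\<lambda>x. \<Sum>i\<in>UNIV. \<psi> x * (H \<epsilon> k x \<bullet> H3 i (e i) x)) = (\<lambda>x. 0)"
  proof
    fix x
    show "(\<Sum>i\<in>UNIV. \<psi> x * (H \<epsilon> k x \<bullet> H3 i (e i) x)) = 0"
      by (cases "x \<in> ball x0 r") (simp_all add: lap test_function_ball_outside[OF \<psi>] flip: sum_distrib_left inner_sum_right)
  qed
  finally have "(\<Sum>i\<in>UNIV. LINT x|lebesgue. \<psi> x * (H \<epsilon> k x \<bullet> H3 i (e i) x)) = 0" by simp
  then show ?thesis by (simp add: first sum.distrib flip: sum_distrib_left)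
qed

text \<open>The Bochner identity forces the weighted L2 norm of the mollified Hessian to 0. As
  \<open>\<psi>\<close> is a probability density, this norm controls the weighted mean of every
  component.\<close>

lemma inner_mollified_Hessian_tendsto_0:
  assumes \<psi>: "test_function (ball x0 r) \<psi>" and nn: "\<And>x. \<psi> x \<ge> 0"
    and one: "(LINT x|lebesgue. \<psi> x) = 1"
    and \<epsilon>: "\<And>n. \<epsilon> n > 0" "\<And>n. r + \<epsilon> n * real CARD('n) < R" "filterlim \<epsilon> (at_right 0) sequentially"
  shows "(\<lambda>n. LINT x|lebesgue. \<psi> x * (H2 (\<epsilon> n) k (e i) x \<bullet> w)) \<longlonglongrightarrow> 0"
proof -
  have r: "r < R" using \<epsilon>(1,2)[of 0] by (smt (verit) mult_nonneg_nonneg of_nat_0_le_iff)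
  have dd: "test_function (ball x0 r) (dird (e i) (dird (e i) \<psi>))" for i
    using \<psi> by (intro test_function_dird)
  let ?E = "\<lambda>n i. LINT x|lebesgue. \<psi> x * (H2 (\<epsilon> n) k (e i) x \<bullet> H2 (\<epsilon> n) k (e i) x)"
  have "(\<lambda>n. \<Sum>i\<in>UNIV. LINT x|lebesgue. dird (e i) (dird (e i) \<psi>) x *
        (\<lambda>V::real^'m^'n. V $ k \<bullet> V $ k) (\<chi> j. conv (moll (\<epsilon> n)) (g j) x))
      \<longlonglongrightarrow> (\<Sum>i\<in>UNIV. LINT x|lebesgue. dird (e i) (dird (e i) \<psi>) x *
        (\<lambda>V::real^'m^'n. V $ k \<bullet> V $ k) (\<chi> j. g j x))"
    by (intro tendsto_sum conv_limit[OF dd _ \<epsilon>(1,3)] continuous_intros)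
  \<comment> \<open>Here the length of \<open>g k\<close> is the constant \<open>c\<close>, so what
    remains is the integral of a derivative with compact support.\<close>
  moreover have "(LINT x|lebesgue. dird (e i) (dird (e i) \<psi>) x * (g k x \<bullet> g k x)) = 0" for i
  proof -
    have "(LINT x|lebesgue. dird (e i) (dird (e i) \<psi>) x * (g k x \<bullet> g k x))
        = (LINT x|lebesgue. dird (e i) (dird (e i) \<psi>) x * c\<^sup>2)"
    proof (rule integral_cong_AE)
      show "AE x in lebesgue. dird (e i) (dird (e i) \<psi>) x * (g k x \<bullet> g k x) = dird (e i) (dird (e i) \<psi>) x * c\<^sup>2"
        using CO
      proof eventually_elim
        case (elim x)
        show ?case
        proof (cases "x \<in> ball x0 R")
          case True
          then obtain L where L: "L \<in> SO_cal \<omega>" "g k x = c *\<^sub>R L (e k)" using elim by blast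
          then have "norm (L (e k)) = 1" by (simp add: SO_cal_def)
          then have "g k x \<bullet> g k x = c\<^sup>2" by (simp add: L(2) dot_square_norm power_mult_distrib)
          then show ?thesis by simp
        next
          case False
          then have "x \<notin> ball x0 r" using r by auto
          then show ?thesis using test_function_ball_outside[OF dd] by simp
        qed
      qed
      have "(\<lambda>x. (\<lambda>V::real^'m^'n. V $ k \<bullet> V $ k) (\<chi> j. g j x)) \<in> borel_measurable lebesgue"
        by (intro compose_g_measurable continuous_intros)
      then have "(\<lambda>x. g k x \<bullet> g k x) \<in> borel_measurable lebesgue" by simp
      then show "(\<lambda>x. dird (e i) (dird (e i) \<psi>) x * (g k x \<bullet> g k x)) \<in> borel_measurable lebesgue"
        by (rule borel_measurable_times[OF continuous_borel_lebesgue[OF test_function_continuous[OF dd]]])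
      show "(\<lambda>x. dird (e i) (dird (e i) \<psi>) x * c\<^sup>2) \<in> borel_measurable lebesgue"
        by (intro borel_measurable_times continuous_borel_lebesgue[OF test_function_continuous[OF dd]] borel_measurable_const)
    qed
    also have "\<dots> = (LINT x|lebesgue. dird (e i) (dird (e i) \<psi>) x) * c\<^sup>2" by simp
    also have "(LINT x|lebesgue. dird (e i) (dird (e i) \<psi>) x) = 0"
    proof (rule integral_dird_eq_0[where u = "dird (e i) \<psi>" and u' = "\<lambda>v. dird v (dird (e i) \<psi>)"])
      show "compact (closure {x. dird (e i) \<psi> x \<noteq> 0})"
        using test_function_dird[OF \<psi>] by (simp add: test_function_def)
    qed (use test_function_has_derivative[OF test_function_dird[OF \<psi>]] test_function_continuous[OF dd] outside_support in blast)+
    finally show ?thesis by simp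
  qed
  ultimately have "(\<lambda>n. 2 * (\<Sum>i\<in>UNIV. ?E n i)) \<longlonglongrightarrow> 0"
    using mollified_Bochner[OF \<psi> \<epsilon>(1)] \<epsilon>(2) by (simp add: less_imp_le)
  from tendsto_mult_right_zero[OF this, of "1 / 2"] have S0: "(\<lambda>n. \<Sum>i\<in>UNIV. ?E n i) \<longlonglongrightarrow> 0"
    by simp
  have E0: "?E n i \<ge> 0" for n i
    using nn by (intro Bochner_Integration.integral_nonneg) simp
  have Ei: "(\<lambda>n. ?E n i) \<longlonglongrightarrow> 0"
  proof (rule tendsto_sandwich[OF _ _ tendsto_const S0])
    show "eventually (\<lambda>n. ?E n i \<le> (\<Sum>i\<in>UNIV. ?E n i)) sequentially"
      using E0 by (intro always_eventually allI member_le_sum) auto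
  qed (use E0 in auto)
  define m where "m n = (LINT x|lebesgue. \<psi> x * (H2 (\<epsilon> n) k (e i) x \<bullet> w))" for n
  \<comment> \<open>Nonnegativity of the variance under \<open>\<psi>\<close> bounds the squared
    mean by the second moment; Cauchy-Schwarz then removes \<open>w\<close>.\<close>
  have "(m n)\<^sup>2 \<le> (w \<bullet> w) * ?E n i" for n
  proof -
    let ?z = "\<lambda>x. H2 (\<epsilon> n) k (e i) x"
    have cz: "continuous_on UNIV (\<lambda>x. ?z x \<bullet> w)" "continuous_on UNIV (\<lambda>x. ?z x \<bullet> ?z x)"
      using H2_cont[OF \<epsilon>(1)] by (auto intro: continuous_on_inner)
    note I1 = test_function_integrable_mult[OF \<psi> cz(1)]
    have I2: "integrable lebesgue (\<lambda>x. \<psi> x * (?z x \<bullet> w)\<^sup>2)"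
      by (intro test_function_integrable_mult[OF \<psi>] continuous_on_power cz)
    have I3: "integrable lebesgue \<psi>" using test_function_integrable_mult[OF \<psi>, of "\<lambda>_. 1"] by simp
    have "0 \<le> (LINT x|lebesgue. \<psi> x * (?z x \<bullet> w - m n)\<^sup>2)"
      using nn by (intro Bochner_Integration.integral_nonneg) simp
    also have "\<dots> = (LINT x|lebesgue. \<psi> x * (?z x \<bullet> w)\<^sup>2 + ((- 2 * m n) * (\<psi> x * (?z x \<bullet> w)) + (m n)\<^sup>2 * \<psi> x))"
      by (intro Bochner_Integration.integral_cong refl) (simp add: power2_eq_square algebra_simps)
    also have "\<dots> = (LINT x|lebesgue. \<psi> x * (?z x \<bullet> w)\<^sup>2) + ((- 2 * m n) * m n + (m n)\<^sup>2 * 1)"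
      using I1 I2 I3 by (simp add: m_def one)
    finally have "(m n)\<^sup>2 \<le> (LINT x|lebesgue. \<psi> x * (?z x \<bullet> w)\<^sup>2)"
      by (simp add: power2_eq_square)
    also have "\<dots> \<le> (LINT x|lebesgue. (w \<bullet> w) * (\<psi> x * (?z x \<bullet> ?z x)))"
    proof (rule integral_mono[OF I2])
      show "integrable lebesgue (\<lambda>x. (w \<bullet> w) * (\<psi> x * (?z x \<bullet> ?z x)))"
        using test_function_integrable_mult[OF \<psi> cz(2)] by simp
      show "\<psi> x * (?z x \<bullet> w)\<^sup>2 \<le> (w \<bullet> w) * (\<psi> x * (?z x \<bullet> ?z x))" for x
        using mult_left_mono[OF Cauchy_Schwarz_ineq[of "?z x" w] nn[of x]] by (simp add: mult_ac)
    qed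
    finally show ?thesis by simp
  qed
  then have "(\<lambda>n. (m n)\<^sup>2) \<longlonglongrightarrow> 0"
    by (intro tendsto_sandwich[OF _ _ tendsto_const tendsto_mult_right_zero[OF Ei, of "w \<bullet> w"]]) auto
  from tendsto_real_sqrt[OF this] have "(\<lambda>n. \<bar>m n\<bar>) \<longlonglongrightarrow> 0" by simp
  then show ?thesis unfolding m_def by (simp add: tendsto_rabs_zero_iff)
qed

text \<open>Integration by parts turns the mollified integrals into weighted means of the Hessian,
  which tend to 0. The normalised nonnegative test functions in view are the reflected
  mollifiers.\<close>

lemma weak_Hessian_zero:
  assumes \<psi>: "test_function (ball x0 r) \<psi>" and r: "r < R" and nn: "\<And>x. \<psi> x \<ge> 0"
    and one: "(LINT x|lebesgue. \<psi> x) = 1"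
  shows "(LINT x|lebesgue. dird (e i) \<psi> x *\<^sub>R g k x) = 0"
proof -
  note d\<psi> = test_function_dird[OF \<psi>]
  obtain \<epsilon> where \<epsilon>: "\<And>n. \<epsilon> n > 0" "\<And>n. r + \<epsilon> n * real CARD('n) < R" "filterlim \<epsilon> (at_right 0) sequentially"
    using small_scales[OF r] by metis
  have scalar: "(LINT x|lebesgue. dird (e i) \<psi> x * (g k x \<bullet> w)) = 0" for w
  proof -
    have "(\<lambda>n. LINT x|lebesgue. dird (e i) \<psi> x * (\<lambda>V::real^'m^'n. V $ k \<bullet> w) (\<chi> j. conv (moll (\<epsilon> n)) (g j) x))
      \<longlonglongrightarrow> (LINT x|lebesgue. dird (e i) \<psi> x * (\<lambda>V::real^'m^'n. V $ k \<bullet> w) (\<chi> j. g j x))"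
      by (intro conv_limit[OF d\<psi> _ \<epsilon>(1,3)] continuous_intros)
    moreover have "(LINT x|lebesgue. dird (e i) \<psi> x * (conv (moll (\<epsilon> n)) (g k) x \<bullet> w))
        = - (LINT x|lebesgue. \<psi> x * (H2 (\<epsilon> n) k (e i) x \<bullet> w))" for n
    proof -
      have eq: "dird (e i) \<psi> x * (conv (moll (\<epsilon> n)) (g k) x \<bullet> w) = dird (e i) \<psi> x * (H (\<epsilon> n) k x \<bullet> w)" for x
      proof (cases "x \<in> ball x0 r")
        case True
        then have "H (\<epsilon> n) k x = conv (moll (\<epsilon> n)) (g k) x"
          using \<epsilon>(1,2)[of n] by (intro conv_weak[of "\<epsilon> n"] corner_test_moll) auto
        then show ?thesis by simp
      qed (simp add: test_function_ball_outside[OF d\<psi>])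
      have "(LINT x|lebesgue. \<psi> x * (H2 (\<epsilon> n) k (e i) x \<bullet> w)) = - (LINT x|lebesgue. dird (e i) \<psi> x * (H (\<epsilon> n) k x \<bullet> w))"
        by (rule integral_by_parts_dird[OF \<psi>, of "\<lambda>x. H (\<epsilon> n) k x \<bullet> w" "\<lambda>v x. H2 (\<epsilon> n) k v x \<bullet> w"])
          (auto intro!: has_derivative_inner_left H_deriv \<epsilon> continuous_on_inner continuous_on_const H2_cont)
      then show ?thesis by (simp only: eq minus_minus)
    qed
    ultimately have "(\<lambda>n. - (LINT x|lebesgue. \<psi> x * (H2 (\<epsilon> n) k (e i) x \<bullet> w))) \<longlonglongrightarrow> (LINT x|lebesgue. dird (e i) \<psi> x * (g k x \<bullet> w))"
      by simp
    moreover have "(\<lambda>n. - (LINT x|lebesgue. \<psi> x * (H2 (\<epsilon> n) k (e i) x \<bullet> w))) \<longlonglongrightarrow> - 0"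
      by (intro tendsto_minus inner_mollified_Hessian_tendsto_0[OF \<psi> nn one \<epsilon>])
    ultimately show ?thesis using LIMSEQ_unique by fastforce
  qed
  let ?I = "LINT x|lebesgue. dird (e i) \<psi> x *\<^sub>R g k x"
  have "?I \<bullet> w = 0" for w
    using scalar[of w] test_function_integrable_scaleR[OF d\<psi> g] by (simp flip: integral_inner_left)
  from this[of ?I] show ?thesis by simp
qed

text \<open>The scale is now fixed: the Hessian of the mollified map at \<open>x\<close> is, up to
  sign, \<open>g k\<close> paired with a derivative of the reflected mollifier, so the weak
  statement makes it exactly zero.\<close>

lemma mollified_Hessian_zero:
  assumes "\<epsilon> > 0" "dist x0 x + \<epsilon> * real CARD('n) < R"
  shows "H2 \<epsilon> k v x = 0"
proof -
  obtain r where r: "dist x0 x + \<epsilon> * real CARD('n) < r" "r < R" using dense[OF assms(2)] by blast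
  have ax: "H2 \<epsilon> k (e i) x = 0" for i
  proof -
    have ml: "corner_test \<epsilon> (moll \<epsilon> :: real^'n \<Rightarrow> real)" using assms(1) by (rule corner_test_moll)
    \<comment> \<open>The order is exchanged so that the outer derivative, in direction
      \<open>e k\<close>, is the one \<open>conv_weak\<close> trades for \<open>g k\<close>.\<close>
    have "H2 \<epsilon> k (e i) x = conv (dird (e k) (dird (e i) (moll \<epsilon>))) f x"
      by (simp add: dird_moll_commute[of "e i"])
    also have "\<dots> = conv (dird (e i) (moll \<epsilon>)) (g k) x"
      by (rule conv_weak[OF corner_test_dird[OF ml] assms])
    also have "\<dots> = - (LINT y|lebesgue. dird (e i) (\<lambda>y. moll \<epsilon> (x - y)) y *\<^sub>R g k y)"
      by (simp add: conv_def dird_reflect[OF corner_test_function[OF ml]])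
    also have "(LINT y|lebesgue. dird (e i) (\<lambda>y. moll \<epsilon> (x - y)) y *\<^sub>R g k y) = 0"
      by (rule weak_Hessian_zero[OF corner_test_reflect[OF ml assms(1) r(1)] r(2)])
        (simp_all add: moll_nonneg moll_integral assms)
    finally show ?thesis by simp
  qed
  have lin: "linear (\<lambda>v. H2 \<epsilon> k v x)" using H_deriv[OF assms(1)] has_derivative_linear by blast
  have "H2 \<epsilon> k (\<Sum>i\<in>UNIV. (v $ i) *\<^sub>R e i) x = (\<Sum>i\<in>UNIV. (v $ i) *\<^sub>R H2 \<epsilon> k (e i) x)"
    by (simp add: linear_sum[OF lin] linear_scale[OF lin])
  then show ?thesis by (simp add: ax axis_rep)
qed

text \<open>A zero derivative on a convex ball means constancy; this is used first for the partials
  and then for the map minus its linear part.\<close>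

lemma mollified_affine:
  assumes \<epsilon>: "\<epsilon> > 0" "r + \<epsilon> * real CARD('n) \<le> R" and x: "x \<in> ball x0 r"
  shows "conv (moll \<epsilon>) f x = conv (moll \<epsilon>) f x0 + (\<Sum>k\<in>UNIV. (x - x0) $ k *\<^sub>R H \<epsilon> k x0)"
proof -
  have x0: "x0 \<in> ball x0 r" using x by (auto intro: le_less_trans[OF zero_le_dist])
  have const: "H \<epsilon> k y = H \<epsilon> k x0" if "y \<in> ball x0 r" for y k
  proof -
    have "\<exists>a. \<forall>y\<in>ball x0 r. H \<epsilon> k y = a"
    proof (rule has_derivative_zero_constant[OF convex_ball])
      fix y assume "y \<in> ball x0 r"
      then have "H2 \<epsilon> k v y = 0" for v using \<epsilon> by (intro mollified_Hessian_zero) auto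
      then show "(H \<epsilon> k has_derivative (\<lambda>h. 0)) (at y within ball x0 r)"
        using has_derivative_at_withinI[OF H_deriv[OF \<epsilon>(1), of k y]] by simp
    qed
    then show ?thesis using that x0 by metis
  qed
  define h where "h y = conv (moll \<epsilon>) f y - (\<Sum>k\<in>UNIV. y $ k *\<^sub>R H \<epsilon> k x0)" for y
  have "\<exists>a. \<forall>y\<in>ball x0 r. h y = a"
  proof (rule has_derivative_zero_constant[OF convex_ball])
    fix y assume y: "y \<in> ball x0 r"
    have d: "(conv (moll \<epsilon>) f has_derivative (\<lambda>v. conv (dird v (moll \<epsilon>)) f y)) (at y)"
      by (rule conv_has_derivative[OF moll_test[OF \<epsilon>(1)] f])
    have lin: "linear (\<lambda>v. conv (dird v (moll \<epsilon>)) f y)" using d has_derivative_linear by blast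
    have eq: "conv (dird v (moll \<epsilon>)) f y = (\<Sum>k\<in>UNIV. v $ k *\<^sub>R H \<epsilon> k x0)" for v
    proof -
      have "conv (dird (\<Sum>k\<in>UNIV. (v $ k) *\<^sub>R e k) (moll \<epsilon>)) f y = (\<Sum>k\<in>UNIV. (v $ k) *\<^sub>R H \<epsilon> k y)"
        by (simp add: linear_sum[OF lin] linear_scale[OF lin])
      then show ?thesis by (simp add: axis_rep const[OF y])
    qed
    have "(h has_derivative (\<lambda>v. conv (dird v (moll \<epsilon>)) f y - (\<Sum>k\<in>UNIV. v $ k *\<^sub>R H \<epsilon> k x0))) (at y)"
      unfolding h_def[abs_def]
      by (intro has_derivative_diff d has_derivative_sum has_derivative_scaleR_left
          bounded_linear.has_derivative[OF bounded_linear_vec_nth] has_derivative_ident)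
    then show "(h has_derivative (\<lambda>h. 0)) (at y within ball x0 r)"
      by (simp add: eq has_derivative_at_withinI)
  qed
  then have "h x = h x0" using x x0 by metis
  then show ?thesis by (simp add: h_def scaleR_diff_left sum_subtractf algebra_simps)
qed

text \<open>The slopes of the affine mollifications are recovered from their values at
  \<open>x0\<close> and at \<open>x0 + s *\<^sub>R e k\<close>, so pointwise convergence of values
  already makes the slopes converge.\<close>

lemma locally_affine:
  assumes cont: "\<And>x. x \<in> ball x0 R \<Longrightarrow> isCont f x"
  shows "\<exists>A b. linear A \<and> (\<forall>x\<in>ball x0 (R / 2). f x = A x + b)"
proof -
  have r: "R / 2 < R" using R by simp
  obtain \<epsilon> where \<epsilon>: "\<And>n. \<epsilon> n > 0" "\<And>n. R / 2 + \<epsilon> n * real CARD('n) < R" "filterlim \<epsilon> (at_right 0) sequentially"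
    using small_scales[OF r] by metis
  \<comment> \<open>Small enough to keep the points \<open>x0 + s *\<^sub>R e k\<close> in the ball
    of radius \<open>R / 2\<close>.\<close>
  define s where "s = R / 4"
  have s: "s > 0" "s < R / 2" using R by (auto simp: s_def)
  define a where "a k = (f (x0 + s *\<^sub>R e k) - f x0) /\<^sub>R s" for k
  have lim: "(\<lambda>n. conv (moll (\<epsilon> n)) f x) \<longlonglongrightarrow> f x" if "x \<in> ball x0 (R / 2)" for x
    using that R by (intro filterlim_compose[OF conv_moll_tendsto_continuous[OF f cont] \<epsilon>(3)]) auto
  have x0: "x0 \<in> ball x0 (R / 2)" using R by simp
  have xk: "x0 + s *\<^sub>R e k \<in> ball x0 (R / 2)" for k using s by (simp add: dist_norm)
  note aff = mollified_affine[OF \<epsilon>(1) less_imp_le[OF \<epsilon>(2)]]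
  have Hk: "H (\<epsilon> n) k x0 = (conv (moll (\<epsilon> n)) f (x0 + s *\<^sub>R e k) - conv (moll (\<epsilon> n)) f x0) /\<^sub>R s" for n k
  proof -
    have "(\<Sum>j\<in>UNIV. (s *\<^sub>R e k) $ j *\<^sub>R H (\<epsilon> n) j x0) = s *\<^sub>R H (\<epsilon> n) k x0"
      by (subst sum.remove[of _ k]) (auto simp: axis_def intro!: sum.neutral)
    then show ?thesis using aff[OF xk, of n k] s by simp
  qed
  have "(\<lambda>n. H (\<epsilon> n) k x0) \<longlonglongrightarrow> a k" for k
    unfolding Hk a_def by (intro tendsto_intros lim xk x0)
  then have "f x = f x0 + (\<Sum>k\<in>UNIV. (x - x0) $ k *\<^sub>R a k)" if "x \<in> ball x0 (R / 2)" for x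
    using LIMSEQ_unique[OF lim[OF that]] unfolding aff[OF that] by (force intro: tendsto_intros lim x0)
  then have "f x = (\<Sum>k\<in>UNIV. x $ k *\<^sub>R a k) + (f x0 - (\<Sum>k\<in>UNIV. x0 $ k *\<^sub>R a k))" if "x \<in> ball x0 (R / 2)" for x
    using that by (simp add: scaleR_diff_left sum_subtractf algebra_simps)
  moreover have "linear (\<lambda>x. \<Sum>k\<in>UNIV. x $ k *\<^sub>R a k)"
    by (auto intro!: linearI simp: scaleR_add_left sum.distrib scaleR_sum_right)
  ultimately show ?thesis by blast
qed

end

section \<open>Passage from local to global\<close>

text \<open>The curve may take arbitrary values off its domain and is only locally integrable there;
  cutting off at a compact set gives integrability on the whole space.\<close>

definition zero_off :: "'a set \<Rightarrow> ('a \<Rightarrow> 'b::zero) \<Rightarrow> 'a \<Rightarrow> 'b" where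
  "zero_off K h x = (if x \<in> K then h x else 0)"

lemma Lp_loc_1_zero_off_integrable:
  fixes h :: "'a::euclidean_space \<Rightarrow> 'b::euclidean_space"
  assumes h: "Lp_loc 1 \<Omega> h" and K: "compact K" "K \<subseteq> \<Omega>" and \<Omega>: "open \<Omega>"
  shows "integrable lebesgue (zero_off K h)"
proof -
  have mK: "K \<in> sets lebesgue" and m\<Omega>: "\<Omega> \<in> sets lebesgue"
    using K(1) \<Omega> by (auto simp: compact_imp_closed lmeasurable_compact fmeasurableD borel_open)
  have "h \<in> borel_measurable (lebesgue_on \<Omega>)" using h by (simp add: Lp_loc_def)
  then have "h \<in> borel_measurable (lebesgue_on K)"
    by (rule measurable_restrict_mono[OF _ K(2)])
  moreover have "integrable (lebesgue_on K) (\<lambda>x. norm (h x))"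
    using h K by (simp add: Lp_loc_def)
  ultimately have "integrable (lebesgue_on K) h"
    by (rule Bochner_Integration.integrable_norm_cancel[rotated])
  then have "integrable lebesgue (\<lambda>x. indicator K x *\<^sub>R h x)"
    using mK by (simp add: integrable_restrict_space)
  also have "(\<lambda>x. indicator K x *\<^sub>R h x) = zero_off K h"
    by (auto simp: zero_off_def indicator_def fun_eq_iff)
  finally show ?thesis .
qed

text \<open>A test function supported in \<open>U\<close>, like its derivatives, does not see the
  cut-off outside \<open>K\<close>.\<close>

lemma has_weak_differential_zero_off:
  fixes F :: "'a::euclidean_space \<Rightarrow> 'b::euclidean_space"
  assumes D: "has_weak_differential F D \<Omega>" and \<Omega>: "open \<Omega>" "U \<subseteq> K" "K \<subseteq> \<Omega>"
    and \<phi>: "test_function U \<phi>"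
  shows "(LINT x|lebesgue. dird v \<phi> x *\<^sub>R zero_off K F x) = - (LINT x|lebesgue. \<phi> x *\<^sub>R zero_off K (\<lambda>x. D x v) x)"
proof -
  have m\<Omega>: "\<Omega> \<in> sets lebesgue" using \<Omega>(1) by (simp add: borel_open)
  have out: "\<psi> x = 0" if "test_function U \<psi>" "x \<notin> K" for \<psi> x
    using that \<Omega>(2) outside_support[of x \<psi>] unfolding test_function_def by blast
  have eq: "(LINT x|lebesgue_on \<Omega>. \<psi> x *\<^sub>R h x) = (LINT x|lebesgue. \<psi> x *\<^sub>R zero_off K h x)"
    if "test_function U \<psi>" for \<psi> and h :: "'a \<Rightarrow> 'b"
  proof -
    have "(LINT x|lebesgue_on \<Omega>. \<psi> x *\<^sub>R h x) = (LINT x|lebesgue. indicator \<Omega> x *\<^sub>R (\<psi> x *\<^sub>R h x))"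
      using m\<Omega> by (simp add: integral_restrict_space)
    also have "\<dots> = (LINT x|lebesgue. \<psi> x *\<^sub>R zero_off K h x)"
      using out[OF that] \<Omega>(3) by (intro Bochner_Integration.integral_cong refl) (auto simp: zero_off_def indicator_def)
    finally show ?thesis .
  qed
  have "test_function \<Omega> \<phi>" using \<phi> \<Omega> by (auto intro: test_function_mono)
  then have "(LINT x|lebesgue_on \<Omega>. dird v \<phi> x *\<^sub>R F x) = - (LINT x|lebesgue_on \<Omega>. \<phi> x *\<^sub>R D x v)"
    using D by (simp add: has_weak_differential_def dird_def)
  then show ?thesis by (simp add: eq[OF \<phi>] eq[OF test_function_dird[OF \<phi>]])
qed

lemma conformal_curve_has_weak_differential:
  "conformal_curve \<omega> \<Omega> F \<Longrightarrow> has_weak_differential F (weak_differential \<Omega> F) \<Omega>"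
  unfolding conformal_curve_def W1p_loc_def weak_differential_def by (metis someI_ex)

text \<open>Nonempty open sets are not null. This extracts the sign of the dilation constant from an
  almost-everywhere statement.\<close>

lemma AE_lebesgue_on_ex:
  assumes "open \<Omega>" "\<Omega> \<noteq> {}" "AE x in lebesgue_on \<Omega>. P x"
  shows "\<exists>x\<in>\<Omega>. P x"
proof (rule ccontr)
  assume "\<not> (\<exists>x\<in>\<Omega>. P x)"
  moreover have "AE x in lebesgue. x \<in> \<Omega> \<longrightarrow> P x"
    using assms by (simp add: AE_restrict_space_iff borel_open)
  ultimately have "AE x in lebesgue. x \<notin> \<Omega>" by (auto elim: eventually_mono)
  then have "negligible \<Omega>"
    using AE_iff_null_sets[of \<Omega> lebesgue] assms(1) by (simp add: negligible_iff_null_sets borel_open)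
  then show False using open_not_negligible assms by blast
qed

text \<open>By Lindelof countably many of the neighbourhoods cover the set, and countably many null
  sets unite to a null set.\<close>

lemma AE_lebesgue_locally:
  fixes \<Omega> :: "'a::euclidean_space set"
  assumes "\<And>x. x \<in> \<Omega> \<Longrightarrow> \<exists>U. open U \<and> x \<in> U \<and> (AE y in lebesgue. y \<in> U \<longrightarrow> P y)"
  shows "AE y in lebesgue. y \<in> \<Omega> \<longrightarrow> P y"
proof -
  obtain U where U: "\<And>x. x \<in> \<Omega> \<Longrightarrow> open (U x) \<and> x \<in> U x \<and> (AE y in lebesgue. y \<in> U x \<longrightarrow> P y)"
    using assms by metis
  obtain \<F> where \<F>: "\<F> \<subseteq> U ` \<Omega>" "countable \<F>" "\<Union>\<F> = \<Union>(U ` \<Omega>)"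
    using Lindelof[of "U ` \<Omega>"] U by (metis imageE)
  have "AE y in lebesgue. \<forall>V\<in>\<F>. y \<in> V \<longrightarrow> P y"
    using \<F> U by (subst AE_ball_countable) auto
  then show ?thesis
  proof eventually_elim
    case (elim y)
    show ?case
    proof
      assume "y \<in> \<Omega>"
      then have "y \<in> \<Union>\<F>" using \<F>(3) U by blast
      then show "P y" using elim by blast
    qed
  qed
qed

text \<open>Slope and intercept are determined by \<open>F\<close> near each point. The pair
  \<open>J\<close> of both is locally constant, hence constant on a connected set.\<close>

lemma locally_affine_imp_affine:
  fixes F :: "'a::euclidean_space \<Rightarrow> 'b::real_normed_vector"
  assumes \<Omega>: "open \<Omega>" "connected \<Omega>" "\<Omega> \<noteq> {}"
    and loc: "\<And>x. x \<in> \<Omega> \<Longrightarrow> \<exists>U A b. open U \<and> x \<in> U \<and> linear A \<and> (\<forall>y\<in>U. F y = A y + b)"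
  shows "affine_map_on \<Omega> F"
proof -
  define dF where "dF x v = dird v F x" for x v
  have dF: "dF y = A" if "open U" "y \<in> U" "linear A" "\<forall>y\<in>U. F y = A y + b" for U y A b
  proof -
    have "((\<lambda>y. A y + b) has_derivative A) (at y)"
      using that(3) by (auto intro!: derivative_eq_intros linear_imp_has_derivative)
    then have "(F has_derivative A) (at y)"
      by (rule has_derivative_transform_within_open[OF _ that(1,2)]) (use that(4) in simp)
    then show ?thesis unfolding dF_def using dird_eqI by blast
  qed
  define J where "J x = (dF x, F x - dF x x)" for x
  have "J constant_on \<Omega>"
  proof (rule locally_constant_imp_constant[OF \<Omega>(2)])
    fix x assume x: "x \<in> \<Omega>"
    obtain U A b where U: "open U" "x \<in> U" "linear A" "\<forall>y\<in>U. F y = A y + b" using loc[OF x] by blast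
    have "J y = (A, b)" if "y \<in> U" for y
      using dF[OF U(1) that U(3,4)] U(4) that by (simp add: J_def)
    then show "\<exists>T. openin (top_of_set \<Omega>) T \<and> x \<in> T \<and> (\<forall>y\<in>T. J y = J x)"
      using U(1,2) x by (intro exI[of _ "\<Omega> \<inter> U"]) auto
  qed
  then obtain A b where Ab: "\<And>x. x \<in> \<Omega> \<Longrightarrow> J x = (A, b)"
    unfolding constant_on_def by (metis surj_pair)
  obtain x where x: "x \<in> \<Omega>" using \<Omega>(3) by blast
  obtain U A' b' where U: "open U" "x \<in> U" "linear A'" "\<forall>y\<in>U. F y = A' y + b'" using loc[OF x] by blast
  have "linear A" using Ab[OF x] dF[OF U] U(3) by (simp add: J_def)
  moreover have "F y = A y + b" if "y \<in> \<Omega>" for y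
    using Ab[OF that] by (auto simp: J_def)
  ultimately show ?thesis unfolding affine_map_on_def by blast
qed

lemma conformal_curve_constant_imp_affine:
  fixes \<omega> :: "('n::finite \<Rightarrow> real^'m::finite) \<Rightarrow> real" and F :: "real^'n \<Rightarrow> real^'m"
  assumes \<omega>: "calibration \<omega>" and \<Omega>: "open \<Omega>" "connected \<Omega>" "\<Omega> \<noteq> {}"
    and F: "conformal_curve \<omega> \<Omega> F"
    and c: "AE x in lebesgue_on \<Omega>. onorm (weak_differential \<Omega> F x) = c"
  shows "affine_map_on \<Omega> F"
proof -
  define D where "D = weak_differential \<Omega> F"
  have D: "has_weak_differential F D \<Omega>"
    unfolding D_def by (rule conformal_curve_has_weak_differential[OF F])
  have "AE x in lebesgue_on \<Omega>. D x \<in> CO_cal \<omega>"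
    using F by (simp add: conformal_curve_def D_def)
  with c have CO: "AE x in lebesgue_on \<Omega>. c \<ge> 0 \<and> (\<exists>L\<in>SO_cal \<omega>. D x = (\<lambda>v. c *\<^sub>R L v))"
  proof eventually_elim
    case (elim x)
    then obtain r L where L: "r \<ge> 0" "L \<in> SO_cal \<omega>" "D x = (\<lambda>v. r *\<^sub>R L v)" by (auto simp: CO_cal_def)
    \<comment> \<open>The dilation factor is the operator norm, so it is the same constant at almost
      every point.\<close>
    then have "r = c"
      using elim(1) onorm_scaled_isometry[of L r] by (simp add: SO_cal_def D_def)
    then show ?case using L by blast
  qed
  then have c0: "c \<ge> 0" using AE_lebesgue_on_ex[OF \<Omega>(1,3)] by blast
  have CO': "AE x in lebesgue. x \<in> \<Omega> \<longrightarrow> (\<exists>L\<in>SO_cal \<omega>. D x = (\<lambda>v. c *\<^sub>R L v))"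
    using CO \<Omega>(1) by (auto simp: AE_restrict_space_iff borel_open elim: eventually_mono)
  show ?thesis
  proof (rule locally_affine_imp_affine[OF \<Omega>])
    fix x0 assume "x0 \<in> \<Omega>"
    then obtain R where Rad: "R > 0" "cball x0 R \<subseteq> \<Omega>" using \<Omega>(1) open_contains_cball by blast
    let ?K = "cball x0 R"
    interpret dilation_ball \<omega> "zero_off ?K F" "\<lambda>i. zero_off ?K (\<lambda>x. D x (axis i 1))" x0 R c
    proof
      show "integrable lebesgue (zero_off ?K F)"
        using D by (intro Lp_loc_1_zero_off_integrable[OF _ _ Rad(2) \<Omega>(1)]) (auto simp: has_weak_differential_def)
      show "integrable lebesgue (zero_off ?K (\<lambda>x. D x (axis i 1)))" for i
        using D by (intro Lp_loc_1_zero_off_integrable[OF _ _ Rad(2) \<Omega>(1)]) (auto simp: has_weak_differential_def)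
      show "(LINT x|lebesgue. dird (axis i 1) \<phi> x *\<^sub>R zero_off ?K F x)
          = - (LINT x|lebesgue. \<phi> x *\<^sub>R zero_off ?K (\<lambda>x. D x (axis i 1)) x)"
        if "test_function (ball x0 R) \<phi>" for \<phi> i
        by (rule has_weak_differential_zero_off[OF D \<Omega>(1) ball_subset_cball Rad(2) that])
      show "AE x in lebesgue. x \<in> ball x0 R \<longrightarrow>
          (\<exists>L\<in>SO_cal \<omega>. \<forall>i. zero_off ?K (\<lambda>x. D x (axis i 1)) x = c *\<^sub>R L (axis i 1))"
        using CO'
      proof eventually_elim
        case (elim x)
        then show ?case using Rad(2) by (force simp: zero_off_def)
      qed
      show "AE x in lebesgue. norm (zero_off ?K (\<lambda>x. D x (axis i 1)) x) \<le> c" for i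
        using CO'
      proof eventually_elim
        case (elim x)
        then show ?case using Rad(2) c0 by (auto simp: zero_off_def SO_cal_def)
      qed
    qed (use \<omega> Rad c0 in auto)
    have "isCont (zero_off ?K F) x" if x: "x \<in> ball x0 R" for x
    proof -
      have "x \<in> \<Omega>" using x Rad(2) by auto
      then have "isCont F x"
        using F \<Omega>(1) by (auto simp: conformal_curve_def continuous_on_eq_continuous_at)
      moreover have "eventually (\<lambda>y. zero_off ?K F y = F y) (nhds x)"
        using x by (intro eventually_nhds_in_open[THEN eventually_mono, of "ball x0 R"]) (auto simp: zero_off_def)
      ultimately show ?thesis using isCont_cong by blast
    qed
    from locally_affine[OF this] obtain A b where "linear A" "\<forall>x\<in>ball x0 (R / 2). zero_off ?K F x = A x + b"
      by blast
    moreover have "zero_off ?K F x = F x" if "x \<in> ball x0 (R / 2)" for x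
      using that Rad(1) by (auto simp: zero_off_def)
    ultimately show "\<exists>U A b. open U \<and> x0 \<in> U \<and> linear A \<and> (\<forall>y\<in>U. F y = A y + b)"
      using Rad(1) by (intro exI[of _ "ball x0 (R / 2)"] exI[of _ A] exI[of _ b]) auto
  qed
qed

text \<open>Uniqueness of the weak differential: the difference \<open>D x v - A v\<close> is
  orthogonal to all test functions on a ball, so its mollification vanishes at each interior point
  for small scales, yet converges to it almost everywhere.\<close>

lemma has_weak_differential_affine:
  fixes F :: "real^'n::finite \<Rightarrow> real^'m::finite"
  assumes D: "has_weak_differential F D \<Omega>" and \<Omega>: "open \<Omega>"
    and A: "linear A" "\<And>x. x \<in> \<Omega> \<Longrightarrow> F x = A x + b"
  shows "AE x in lebesgue_on \<Omega>. D x = A"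
proof -
  have lA: "linear A" by fact
  have ax: "AE x in lebesgue. x \<in> \<Omega> \<longrightarrow> D x v = A v" for v
  proof (rule AE_lebesgue_locally)
    fix x0 assume "x0 \<in> \<Omega>"
    then obtain R where R: "R > 0" "cball x0 R \<subseteq> \<Omega>" using \<Omega>(1) open_contains_cball by blast
    let ?K = "cball x0 R"
    let ?h = "\<lambda>x. zero_off ?K (\<lambda>x. D x v) x - zero_off ?K (\<lambda>x. A v) x"
    have iD: "integrable lebesgue (zero_off ?K (\<lambda>x. D x v))"
      using D by (intro Lp_loc_1_zero_off_integrable[OF _ _ R(2) \<Omega>(1)]) (auto simp: has_weak_differential_def)
    have iA: "integrable lebesgue (zero_off ?K (\<lambda>x. A v))"
    proof -
      have "integrable lebesgue (\<lambda>x. indicator ?K x *\<^sub>R A v)"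
        by (intro integrable_scaleR_left integrable_real_indicator) (use emeasure_bounded_finite[of ?K] in \<open>auto simp: borel_closed\<close>)
      also have "(\<lambda>x. indicator ?K x *\<^sub>R A v) = zero_off ?K (\<lambda>x. A v)" by (auto simp: zero_off_def indicator_def fun_eq_iff)
      finally show ?thesis .
    qed
    have ih: "integrable lebesgue ?h" using iD iA by (rule Bochner_Integration.integrable_diff)
    have zero: "(LINT x|lebesgue. \<phi> x *\<^sub>R ?h x) = 0" if \<phi>: "test_function (ball x0 R) \<phi>" for \<phi>
    proof -
      have out: "\<psi> x = 0" if "test_function (ball x0 R) \<psi>" "x \<notin> ?K" for \<psi> :: "real^'n \<Rightarrow> real" and x
        using that outside_support[of x \<psi>] ball_subset_cball[of x0 R] unfolding test_function_def by blast
      note int = test_function_integrable_scaleR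
      have iF: "integrable lebesgue (zero_off ?K F)"
        using D by (intro Lp_loc_1_zero_off_integrable[OF _ _ R(2) \<Omega>(1)]) (auto simp: has_weak_differential_def)
      note w = has_weak_differential_zero_off[OF D \<Omega>(1) ball_subset_cball R(2) \<phi>, of v]
      \<comment> \<open>Paired with \<open>u\<close> because integration by parts was proved for
        real-valued functions.\<close>
      have "(LINT x|lebesgue. \<phi> x *\<^sub>R zero_off ?K (\<lambda>x. D x v) x) \<bullet> u = (LINT x|lebesgue. \<phi> x *\<^sub>R zero_off ?K (\<lambda>x. A v) x) \<bullet> u" for u
      proof -
        have "((\<lambda>x. (A x + b) \<bullet> u) has_derivative (\<lambda>v. A v \<bullet> u)) (at x)" for x
          using linear_imp_has_derivative[OF lA] by (auto intro!: derivative_eq_intros)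
        from integral_by_parts_dird[OF \<phi> this, of v]
        have p: "(LINT x|lebesgue. \<phi> x * (A v \<bullet> u)) = - (LINT x|lebesgue. dird v \<phi> x * ((A x + b) \<bullet> u))"
          by simp
        have "(LINT x|lebesgue. \<phi> x *\<^sub>R zero_off ?K (\<lambda>x. D x v) x) \<bullet> u = - (LINT x|lebesgue. dird v \<phi> x *\<^sub>R zero_off ?K F x) \<bullet> u"
          unfolding w by simp
        also have "\<dots> = - (LINT x|lebesgue. (dird v \<phi> x *\<^sub>R zero_off ?K F x) \<bullet> u)"
          using int[OF test_function_dird[OF \<phi>] iF] by (simp only: integral_inner_left inner_minus_left)
        also have "\<dots> = - (LINT x|lebesgue. dird v \<phi> x * ((A x + b) \<bullet> u))"
        proof -
          have "(dird v \<phi> x *\<^sub>R zero_off ?K F x) \<bullet> u = dird v \<phi> x * ((A x + b) \<bullet> u)" for x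
            using out[OF test_function_dird[OF \<phi>], of x v] A(2)[of x] R(2) by (auto simp: zero_off_def)
          then show ?thesis by (simp only:)
        qed
        also have "\<dots> = (LINT x|lebesgue. (\<phi> x *\<^sub>R zero_off ?K (\<lambda>x. A v) x) \<bullet> u)"
        proof -
          have "\<phi> x * (A v \<bullet> u) = (\<phi> x *\<^sub>R zero_off ?K (\<lambda>x. A v) x) \<bullet> u" for x
            using out[OF \<phi>, of x] by (auto simp: zero_off_def)
          then show ?thesis unfolding p[symmetric] by (simp only:)
        qed
        also have "\<dots> = (LINT x|lebesgue. \<phi> x *\<^sub>R zero_off ?K (\<lambda>x. A v) x) \<bullet> u"
          using int[OF \<phi> iA] by (simp only: integral_inner_left)
        finally show ?thesis .
      qed
      then have "(LINT x|lebesgue. \<phi> x *\<^sub>R zero_off ?K (\<lambda>x. D x v) x) = (LINT x|lebesgue. \<phi> x *\<^sub>R zero_off ?K (\<lambda>x. A v) x)"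
        by (rule vector_eq_rdot[THEN iffD1, OF allI])
      then show ?thesis
        using int[OF \<phi> iD] int[OF \<phi> iA] by (simp add: scaleR_diff_right)
    qed
    have "AE x in lebesgue. x \<in> ball x0 R \<longrightarrow> D x v = A v"
      using conv_moll_tendsto_AE[OF ih]
    proof eventually_elim
      case (elim x)
      show ?case
      proof
        assume x: "x \<in> ball x0 R"
        define d where "d = (R - dist x0 x) / real CARD('n)"
        have d: "d > 0" using x by (simp add: d_def)
        have "conv (moll \<epsilon>) ?h x = 0" if "0 < \<epsilon>" "\<epsilon> < d" for \<epsilon>
        proof -
          have lt: "dist x0 x + \<epsilon> * real CARD('n) < R" using that(2) by (simp add: d_def field_simps)
          have "test_function (ball x0 R) (\<lambda>y. moll \<epsilon> (x - y))"
          proof (rule test_function_reflect[OF moll_test[OF that(1)] compact_cbox moll_outside[OF that(1)]])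
            fix z :: "real^'n" assume z: "z \<in> cbox (- \<epsilon> *\<^sub>R One) 0"
            have "x - z \<in> cbox x (x + \<epsilon> *\<^sub>R One)"
              using z by (auto simp: mem_box inner_simps algebra_simps)
            then have "dist x (x - z) \<le> \<epsilon> * real CARD('n)"
              using norm_cbox_corner[OF _ that(1)] by (fastforce simp: dist_norm norm_minus_commute)
            then show "x - z \<in> ball x0 R" using lt dist_triangle[of x0 "x - z" x] by simp
          qed
          from zero[OF this] show ?thesis unfolding conv_def .
        qed
        then have "eventually (\<lambda>\<epsilon>. conv (moll \<epsilon>) ?h x = 0) (at_right 0)"
          unfolding eventually_at_right_field using d by blast
        then have "((\<lambda>\<epsilon>. conv (moll \<epsilon>) ?h x) \<longlongrightarrow> 0) (at_right 0)" by (rule tendsto_eventually)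
        with elim have "?h x = 0" using tendsto_unique trivial_limit_at_right_real by blast
        then show "D x v = A v" using x by (simp add: zero_off_def)
      qed
    qed
    then show "\<exists>U. open U \<and> x0 \<in> U \<and> (AE y in lebesgue. y \<in> U \<longrightarrow> D y v = A v)"
      using R(1) by (intro exI[of _ "ball x0 R"]) auto
  qed
  \<comment> \<open>The null set depends on \<open>v\<close>; finitely many basis directions suffice
    since both maps are linear.\<close>
  have "AE x in lebesgue. \<forall>i\<in>(UNIV::'n set). x \<in> \<Omega> \<longrightarrow> D x (axis i 1) = A (axis i 1)"
    by (intro AE_finite_allI ax) auto
  then have "AE x in lebesgue. x \<in> \<Omega> \<longrightarrow> D x = A"
  proof eventually_elim
    case (elim x)
    show ?case
    proof
      assume "x \<in> \<Omega>"
      then have i: "D x (axis i 1) = A (axis i 1)" for i using elim by blast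
      have lD: "linear (D x)" using D by (simp add: has_weak_differential_def)
      have "D x (\<Sum>i\<in>UNIV. (v $ i) *\<^sub>R axis i 1) = A (\<Sum>i\<in>UNIV. (v $ i) *\<^sub>R axis i 1)" for v
        by (simp add: linear_sum[OF lD] linear_scale[OF lD] linear_sum[OF lA] linear_scale[OF lA] i)
      then show "D x = A" by (simp add: axis_rep fun_eq_iff)
    qed
  qed
  then show ?thesis using \<Omega> by (simp add: AE_restrict_space_iff borel_open)
qed

theorem theorem1p2:
  fixes \<omega> :: "('n::finite \<Rightarrow> real^'m::finite) \<Rightarrow> real"
    and \<Omega> :: "(real^'n) set"
    and F :: "real^'n \<Rightarrow> real^'m"
  assumes "2 \<le> CARD('n)" and "CARD('n) \<le> CARD('m)"
    and "calibration \<omega>"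
    and "open \<Omega>" and "connected \<Omega>" and "\<Omega> \<noteq> {}"
    and "conformal_curve \<omega> \<Omega> F"
  shows "affine_map_on \<Omega> F \<longleftrightarrow>
    (\<exists>c::real. AE x in lebesgue_on \<Omega>. onorm (weak_differential \<Omega> F x) = c)"
proof
  assume "affine_map_on \<Omega> F"
  then obtain A b where A: "linear A" "\<And>x. x \<in> \<Omega> \<Longrightarrow> F x = A x + b"
    by (auto simp: affine_map_on_def)
  have "AE x in lebesgue_on \<Omega>. weak_differential \<Omega> F x = A"
    by (rule has_weak_differential_affine[OF conformal_curve_has_weak_differential[OF assms(7)] assms(4) A])
  then show "\<exists>c. AE x in lebesgue_on \<Omega>. onorm (weak_differential \<Omega> F x) = c"
    by (intro exI[of _ "onorm A"]) (auto elim: eventually_mono)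
next
  assume "\<exists>c. AE x in lebesgue_on \<Omega>. onorm (weak_differential \<Omega> F x) = c"
  then show "affine_map_on \<Omega> F"
    using conformal_curve_constant_imp_affine assms by blast
qed

end
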